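(* (Solution of the generalized Abel equation.) Let $x$ be a non-uniform lattice, $a,\gamma,\alpha\in\mathbb{C}$, and let $m$ be an integer with $0<m-1<\operatorname{Re}\alpha\le m$. Suppose functions $f,g:\{a+1,a+2,\dots\}\to\mathbb{C}$ satisfy $$\nabla_\gamma^{-\alpha}g(z)=f(z)\qquad(z\in\{a+1,a+2,\dots\}).$$ Then $$g(z)=\nabla_\gamma^{m}\,\nabla_{\gamma+\alpha}^{-m+\alpha}f(z)\qquad(z\in\{a+1,a+2,\dots\}).$$
   Context: Non-uniform lattice: a function $x:\mathbb{C}\to\mathbb{C}$ of one of the two forms (Q) $x(s)=\tilde c_1s^2+\tilde c_2s+\tilde c_3$ with $\tilde c_1\tilde c_2\neq0$, or (q) $x(s)=c_1q^{s}+c_2q^{-s}+c_3$ with $c_1c_2\ne0$, where $q\in\mathbb{C}\setminus\{0\}$, $|q|\neq1$, a value of $\log q$ is fixed and $q^s=e^{s\log q}$. For $\nu\in\mathbb{C}$, $x_\nu(s)=x(s+\nu/2)$. $\nabla F(s)=F(s)-F(s-1)$. Gamma functions: in case (Q), $[\Gamma(\alpha)]_q=\Gamma(\alpha)$. In case (q), $[\Gamma(\alpha)]_q=q^{-(\alpha-1)(\alpha-2)/4}\Gamma_q(\alpha)$, where $\Gamma_q(s)=\frac{\prod_{k\ge0}(1-q^{k+1})}{(1-q)^{s-1}\prod_{k\ge0}(1-q^{s+k})}$ for $|q|<1$ and $\Gamma_q(s)=q^{(s-1)(s-2)/2}\Gamma_{1/q}(s)$ for $|q|>1$. Generalized powers: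 for $S,Z,\mu\in\mathbb{C}$, in case (Q) with $c=\tilde c_2/\tilde c_1$, $[x(S)-x(Z)]^{(\mu)}=\tilde c_1^{\,\mu}\frac{\Gamma(S-Z+\mu)\Gamma(S+Z+c+1)}{\Gamma(S-Z)\Gamma(S+Z-\mu+c+1)}$; in case (q) with $c=\log(c_1/c_2)/\log q$, $[x(S)-x(Z)]^{(\mu)}=[c_2(1-q)^2]^{\mu}q^{-\mu S}\frac{\Gamma_q(S-Z+\mu)\Gamma_q(S+Z+c+1)}{\Gamma_q(S-Z)\Gamma_q(S+Z-\mu+c+1)}$. $[x_\nu(s)-x_\nu(t)]^{(\mu)}$ means this expression with $S=s+\nu/2$, $Z=t+\nu/2$. Complex powers of constants use fixed logarithms; $1/\Gamma$, $1/\Gamma_q$ are $0$ at poles. Differences: $\nabla_\gamma F(z)=\nabla F(z)/\nabla x_\gamma(z)$ and $\nabla_\gamma^kF(z)=\frac{\nabla}{\nabla x_\gamma(z)}\Big(\frac{\nabla}{\nabla x_{\gamma+1}(z)}\cdots\Big(\frac{\nabla F(z)}{\nabla x_{\gamma+k-1}(z)}\Big)\Big)$, $k=1,2,\dots$. Fractional sum (based at $a$), for $h:\{a+1,a+2,\dots\}\to\mathbb{C}$: $$\nabla_\gamma^{-\alpha}h(z)=\frac1{[\Gamma(\alpha)]_q}\sum_{t=a+1}^{z}[x_{\gamma+\alpha-1}(z)-x_{\gamma+\alpha-1}(t-1)]^{(\alpha-1)}h(t)\,\nabla x_\gamma(t),\quad z\in\{a+1,a+2,\dots\};$$ the same formula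 is used for all exponents with $\operatorname{Re}\alpha\ge0$, $\alpha\neq0$, and $\nabla_\gamma^{0}$ is the identity. Functions of this form are extended by $0$ (empty sums) to the points $a,a-1,a-2,\dots$ when differences are applied to them (for $\nabla^0_\gamma h=h$ likewise). Convention: all ($q$-)Gamma values occurring in numerators are assumed finite and all increments $\nabla x_\rho(s)$ occurring as denominators nonzero. *)

theory Defs
  imports "HOL-Analysis.Analysis"
begin

text \<open>
  A non-uniform lattice is given by its coefficients together with the fixed values of the
  logarithms on which the complex powers depend:
  \<^item> \<open>QuadLat c1 c2 c3 l\<close>: \<open>x(s) = c1 s^2 + c2 s + c3\<close>, with \<open>l\<close> a logarithm of \<open>c1\<close>;
  \<^item> \<open>ExpLat q c1 c2 c3 lq lc lp lk\<close>: \<open>x(s) = c1 q^s + c2 q^(-s) + c3\<close>, with \<open>lq\<close>, \<open>lc\<close>, \<open>lk\<close>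
    logarithms of \<open>q\<close>, \<open>c1/c2\<close>, \<open>c2 (1-q)^2\<close>, and \<open>lp\<close> a logarithm of \<open>1-q\<close> if \<open>|q| < 1\<close>
    and of \<open>1-1/q\<close> if \<open>|q| > 1\<close>.
  Powers of \<open>1/q\<close> use the logarithm \<open>-lq\<close>.
\<close>

datatype lattice =
    QuadLat complex complex complex complex
  | ExpLat complex complex complex complex complex complex complex complex

fun nonuniform_lattice :: "lattice \<Rightarrow> bool" where
  "nonuniform_lattice (QuadLat c1 c2 c3 l) \<longleftrightarrow> c1 * c2 \<noteq> 0 \<and> exp l = c1"
| "nonuniform_lattice (ExpLat q c1 c2 c3 lq lc lp lk) \<longleftrightarrow>
     c1 * c2 \<noteq> 0 \<and> q \<noteq> 0 \<and> norm q \<noteq> 1 \<and> exp lq = q \<and> exp lc = c1 / c2 \<and>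
     exp lp = (if norm q < 1 then 1 - q else 1 - 1 / q) \<and> exp lk = c2 * (1 - q)\<^sup>2"

fun lat :: "lattice \<Rightarrow> complex \<Rightarrow> complex" where
  "lat (QuadLat c1 c2 c3 l) s = c1 * s\<^sup>2 + c2 * s + c3"
| "lat (ExpLat q c1 c2 c3 lq lc lp lk) s = c1 * exp (s * lq) + c2 * exp (- s * lq) + c3"

definition lat_shift :: "lattice \<Rightarrow> complex \<Rightarrow> complex \<Rightarrow> complex" where
  "lat_shift L \<nu> s = lat L (s + \<nu> / 2)"

definition nabla :: "(complex \<Rightarrow> complex) \<Rightarrow> complex \<Rightarrow> complex" where
  "nabla F s = F s - F (s - 1)"

text \<open>
  In \<open>q_Gamma_small lq lp\<close> the base is \<open>q = exp lq\<close> with \<open>|q| < 1\<close>, and \<open>lp\<close> is a logarithm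
  of \<open>1-q\<close>. At a pole the second product is 0, so division by zero makes the value 0 there, as
  for \<open>Gamma\<close>; hence a quotient by such a value is 0, which is the convention \<open>1/\<Gamma> = 0\<close> at poles.
\<close>

definition q_Gamma_small :: "complex \<Rightarrow> complex \<Rightarrow> complex \<Rightarrow> complex" where
  "q_Gamma_small lq lp s =
     (\<Prod>k. 1 - exp lq ^ (k + 1)) /
     (exp ((s - 1) * lp) * (\<Prod>k. 1 - exp ((s + of_nat k) * lq)))"

definition q_Gamma :: "complex \<Rightarrow> complex \<Rightarrow> complex \<Rightarrow> complex" where
  "q_Gamma lq lp s =
     (if norm (exp lq) < 1 then q_Gamma_small lq lp s
      else exp ((s - 1) * (s - 2) / 2 * lq) * q_Gamma_small (- lq) lp s)"

fun lat_Gamma :: "lattice \<Rightarrow> complex \<Rightarrow> complex" where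
  "lat_Gamma (QuadLat c1 c2 c3 l) s = Gamma s"
| "lat_Gamma (ExpLat q c1 c2 c3 lq lc lp lk) s = q_Gamma lq lp s"

text \<open>Finiteness of the (\<open>q\<close>-)Gamma value at \<open>s\<close>; the condition for \<open>1/q\<close> is the same as for \<open>q\<close>.\<close>

fun lat_Gamma_finite :: "lattice \<Rightarrow> complex \<Rightarrow> bool" where
  "lat_Gamma_finite (QuadLat c1 c2 c3 l) s \<longleftrightarrow> s \<notin> \<int>\<^sub>\<le>\<^sub>0"
| "lat_Gamma_finite (ExpLat q c1 c2 c3 lq lc lp lk) s \<longleftrightarrow>
     (\<forall>k::nat. exp ((s + of_nat k) * lq) \<noteq> 1)"

text \<open>The bracketed \<open>[\<Gamma>(\<alpha>)]\<^sub>q\<close>.\<close>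

fun bracket_Gamma :: "lattice \<Rightarrow> complex \<Rightarrow> complex" where
  "bracket_Gamma (QuadLat c1 c2 c3 l) \<alpha> = Gamma \<alpha>"
| "bracket_Gamma (ExpLat q c1 c2 c3 lq lc lp lk) \<alpha> =
     exp (- ((\<alpha> - 1) * (\<alpha> - 2) / 4) * lq) * q_Gamma lq lp \<alpha>"

fun lat_c :: "lattice \<Rightarrow> complex" where
  "lat_c (QuadLat c1 c2 c3 l) = c2 / c1"
| "lat_c (ExpLat q c1 c2 c3 lq lc lp lk) = lc / lq"

fun power_prefactor :: "lattice \<Rightarrow> complex \<Rightarrow> complex \<Rightarrow> complex" where
  "power_prefactor (QuadLat c1 c2 c3 l) S \<mu> = exp (\<mu> * l)"
| "power_prefactor (ExpLat q c1 c2 c3 lq lc lp lk) S \<mu> = exp (\<mu> * lk) * exp (- \<mu> * S * lq)"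

text \<open>\<open>gen_power L S Z \<mu>\<close> is \<open>[x(S) - x(Z)]\<close> to the generalized power \<open>\<mu>\<close>.\<close>

definition gen_power :: "lattice \<Rightarrow> complex \<Rightarrow> complex \<Rightarrow> complex \<Rightarrow> complex" where
  "gen_power L S Z \<mu> =
     power_prefactor L S \<mu> *
     (lat_Gamma L (S - Z + \<mu>) * lat_Gamma L (S + Z + lat_c L + 1)) /
     (lat_Gamma L (S - Z) * lat_Gamma L (S + Z - \<mu> + lat_c L + 1))"

definition gen_power_finite :: "lattice \<Rightarrow> complex \<Rightarrow> complex \<Rightarrow> complex \<Rightarrow> bool" where
  "gen_power_finite L S Z \<mu> \<longleftrightarrow>
     lat_Gamma_finite L (S - Z + \<mu>) \<and> lat_Gamma_finite L (S + Z + lat_c L + 1)"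

fun nabla_iter :: "lattice \<Rightarrow> complex \<Rightarrow> nat \<Rightarrow> (complex \<Rightarrow> complex) \<Rightarrow> complex \<Rightarrow> complex" where
  "nabla_iter L \<gamma> 0 F = F"
| "nabla_iter L \<gamma> (Suc k) F =
     (\<lambda>z. nabla (nabla_iter L (\<gamma> + 1) k F) z / nabla (lat_shift L \<gamma>) z)"

text \<open>
  The denominators in \<open>nabla_iter L \<gamma> m F z\<close>: the factor with index \<open>\<gamma> + k\<close> lies below \<open>k\<close>
  outer backward differences, hence is evaluated at \<open>z, z-1, \<dots>, z-k\<close>.
\<close>

definition nabla_iter_denoms_nonzero :: "lattice \<Rightarrow> complex \<Rightarrow> nat \<Rightarrow> complex \<Rightarrow> bool" where
  "nabla_iter_denoms_nonzero L \<gamma> m z \<longleftrightarrow>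
     (\<forall>k<m. \<forall>j\<le>k. nabla (lat_shift L (\<gamma> + of_nat k)) (z - of_nat j) \<noteq> 0)"

text \<open>\<open>ray a\<close> is \<open>{a+1, a+2, \<dots>}\<close>, and \<open>segment a z\<close> is \<open>{a+1, \<dots>, z}\<close>, which is empty unless
  \<open>z \<in> ray a\<close>.\<close>

definition ray :: "complex \<Rightarrow> complex set" where
  "ray a = {a + of_nat k | k::nat. k \<ge> 1}"

definition segment :: "complex \<Rightarrow> complex \<Rightarrow> complex set" where
  "segment a z = {t \<in> ray a. \<exists>j::nat. z = t + of_nat j}"

text \<open>
  \<open>frac_sum L a \<gamma> \<alpha> h\<close> is the fractional sum of order \<open>\<alpha>\<close> (that is, the nabla operator with
  exponent \<open>-\<alpha>\<close>) of \<open>h\<close>. Only the values of \<open>h\<close> on \<open>ray a\<close> are used, and the result is 0 off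
  \<open>ray a\<close>, in particular at \<open>a, a-1, \<dots>\<close>.
\<close>

definition frac_sum ::
    "lattice \<Rightarrow> complex \<Rightarrow> complex \<Rightarrow> complex \<Rightarrow> (complex \<Rightarrow> complex) \<Rightarrow> complex \<Rightarrow> complex" where
  "frac_sum L a \<gamma> \<alpha> h z =
     (if \<alpha> = 0 then (if z \<in> ray a then h z else 0)
      else 1 / bracket_Gamma L \<alpha> *
        (\<Sum>t\<in>segment a z.
           gen_power L (z + (\<gamma> + \<alpha> - 1) / 2) (t - 1 + (\<gamma> + \<alpha> - 1) / 2) (\<alpha> - 1) *
           h t * nabla (lat_shift L \<gamma>) t))"

text \<open>All numerator Gamma values in the fractional sum of order \<open>\<alpha>\<close> are finite.\<close>

definition frac_sum_finite :: "lattice \<Rightarrow> complex \<Rightarrow> complex \<Rightarrow> complex \<Rightarrow> bool" where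
  "frac_sum_finite L a \<gamma> \<alpha> \<longleftrightarrow>
     \<alpha> = 0 \<or>
     (\<forall>z\<in>ray a. \<forall>t\<in>segment a z.
        gen_power_finite L (z + (\<gamma> + \<alpha> - 1) / 2) (t - 1 + (\<gamma> + \<alpha> - 1) / 2) (\<alpha> - 1))"

end

theory Submission
  imports Defs
begin

text \<open>
  In symmetric brackets, \<open>y\<close> respectively \<open>q^(y/2) - q^(-y/2)\<close>, the increments of \<open>x\<close> are
  \<open>\<nabla>x_\<rho>(s) = C [2s + \<rho> - 1 + c]\<close>, and the fractional sum of order \<open>\<mu>\<close> has the kernel
  \<open>K_\<mu>(z,t) = \<Prod>i<n. [\<mu>+i]/[i+1]\<close> times a Gamma quotient in \<open>z + t\<close>, where \<open>n = z - t\<close>. This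
  kernel makes sense for every \<open>\<mu>\<close>, and a difference \<open>\<nabla>/\<nabla>x_(\<rho>+\<mu>-1)\<close> lowers \<open>\<mu>\<close> by one.
  Hence the \<open>m\<close> differences turn the fractional sum of order \<open>m - \<alpha>\<close> into the sum with kernel
  \<open>K_(-\<alpha>)\<close>. This is inverse to the sum with kernel \<open>K_\<alpha>\<close>, because the convolution of the two
  kernels is a terminating very-well-poised sum that telescopes. All Gamma values that occur on the
  way are finite: since \<open>m \<ge> 2\<close>, the increments of both \<open>x_\<gamma>\<close> and \<open>x_(\<gamma>+1)\<close> are nonzero, which
  covers the arguments of both parities.
\<close>

section \<open>The Gamma functions\<close>

text \<open>The set of poles is closed under subtracting 1, so finiteness at the smallest argument
  of a family settles all later ones.\<close>

lemma lat_Gamma_finite_add_nat: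
  assumes "lat_Gamma_finite L w"
  shows "lat_Gamma_finite L (w + of_nat n)"
proof (cases L)
  case (QuadLat c1 c2 c3 l)
  with assms have "w \<notin> \<int>\<^sub>\<le>\<^sub>0" by simp
  have "w + of_nat n \<notin> \<int>\<^sub>\<le>\<^sub>0"
  proof
    assume "w + of_nat n \<in> \<int>\<^sub>\<le>\<^sub>0"
    then obtain k where "w + of_nat n = - of_nat k" by (elim nonpos_Ints_cases')
    then have "w = - of_nat (n + k)" by (simp add: algebra_simps eq_neg_iff_add_eq_0)
    with \<open>w \<notin> \<int>\<^sub>\<le>\<^sub>0\<close> show False by (metis minus_of_nat_in_nonpos_Ints)
  qed
  with QuadLat show ?thesis by simp
next
  case (ExpLat q c1 c2 c3 lq lc lp lk)
  show ?thesis unfolding ExpLat lat_Gamma_finite.simps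
  proof
    fix k
    have "exp ((w + of_nat (n + k)) * lq) \<noteq> 1"
      using assms ExpLat by (metis lat_Gamma_finite.simps(2))
    then show "exp ((w + of_nat n + of_nat k) * lq) \<noteq> 1" by (simp add: add.assoc)
  qed
qed

lemma convergent_q_Gamma_product:
  fixes lq s :: complex
  assumes q: "norm (exp lq) < 1" and s: "\<And>k::nat. exp ((s + of_nat k) * lq) \<noteq> 1"
  shows "convergent_prod (\<lambda>k. 1 - exp ((s + of_nat k) * lq))"
proof -
  have eq: "exp ((s + of_nat k) * lq) = exp (s * lq) * exp lq ^ k" for k
    by (simp add: exp_of_nat_mult[symmetric] exp_add[symmetric] algebra_simps)
  have "summable (\<lambda>k. norm (exp (s * lq)) * norm (exp lq) ^ k)"
    using q by (intro summable_mult summable_geometric) simp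
  then have "summable (\<lambda>k. norm (- exp ((s + of_nat k) * lq)))"
    by (simp add: eq norm_mult norm_power)
  from summable_imp_convergent_prod_complex[OF this] s show ?thesis by simp
qed

text \<open>Passing from \<open>s\<close> to \<open>s + 1\<close> drops the head factor 1 - q^s of
  the infinite product and adds one factor 1 - q to the power.\<close>

lemma q_Gamma_small_plus1:
  assumes q: "norm (exp lq) < 1" and lp: "exp lp = 1 - exp lq"
    and s: "\<And>k::nat. exp ((s + of_nat k) * lq) \<noteq> 1"
  shows "q_Gamma_small lq lp (s + 1) = (1 - exp (s * lq)) / (1 - exp lq) * q_Gamma_small lq lp s"
    and "q_Gamma_small lq lp s \<noteq> 0"
proof -
  let ?f = "\<lambda>k::nat. 1 - exp ((s + of_nat k) * lq)"
  have conv: "convergent_prod ?f" by (rule convergent_q_Gamma_product[OF q s])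
  have nz: "prodinf ?f \<noteq> 0" by (rule prodinf_nonzero[OF conv]) (use s in simp)
  have s0: "exp (s * lq) \<noteq> 1" using s[of 0] by simp
  have q1: "exp lq \<noteq> 1" using q by (metis less_irrefl norm_one)
  have "(\<Prod>k. 1 - exp ((s + 1 + of_nat k) * lq)) = (\<Prod>k. ?f (Suc k))"
    by (simp add: algebra_simps)
  also have "\<dots> = prodinf ?f / (1 - exp (s * lq))"
    using prodinf_split_head[OF conv] s0 by simp
  finally have shift: "(\<Prod>k. 1 - exp ((s + 1 + of_nat k) * lq)) = prodinf ?f / (1 - exp (s * lq))" .
  have "exp (s * lp) = exp ((s - 1) * lp) * (1 - exp lq)"
    by (simp add: lp[symmetric] exp_add[symmetric] algebra_simps)
  then show "q_Gamma_small lq lp (s + 1) = (1 - exp (s * lq)) / (1 - exp lq) * q_Gamma_small lq lp s"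
    unfolding q_Gamma_small_def shift using nz s0 q1 by (simp add: divide_simps)
  \<comment> \<open>The numerator product is the denominator product at \<open>s = 1\<close>, so it
    is nonzero by the same argument.\<close>
  have "exp ((1 + of_nat k) * lq) \<noteq> 1" for k
  proof -
    have "exp ((1 + of_nat k) * lq) = exp lq ^ Suc k"
      by (simp add: exp_of_nat_mult[symmetric] exp_add[symmetric] algebra_simps)
    moreover have "norm (exp lq ^ Suc k) < 1" unfolding norm_power
      using q by (intro power_Suc_less_one) auto
    ultimately show ?thesis by (metis less_irrefl norm_one)
  qed
  then have "(\<Prod>k. 1 - exp ((1 + of_nat k) * lq)) \<noteq> 0"
    by (intro prodinf_nonzero convergent_q_Gamma_product q) auto
  moreover have "exp ((1 + of_nat k) * lq) = exp lq ^ (k + 1)" for k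
    by (simp add: exp_of_nat_mult[symmetric] exp_add[symmetric] algebra_simps)
  ultimately show "q_Gamma_small lq lp s \<noteq> 0"
    unfolding q_Gamma_small_def using nz by simp
qed

text \<open>For |q| > 1 the prefactor q^((s-1)(s-2)/2) grows by q^(s-1), which turns the factor (1 -
  q^(-s))/(1 - 1/q) of base 1/q into (1 - q^s)/(1 - q).\<close>

lemma q_Gamma_plus1:
  assumes q: "norm (exp lq) \<noteq> 1"
    and lp: "exp lp = (if norm (exp lq) < 1 then 1 - exp lq else 1 - 1 / exp lq)"
    and s: "\<And>k::nat. exp ((s + of_nat k) * lq) \<noteq> 1"
  shows "q_Gamma lq lp (s + 1) = (1 - exp (s * lq)) / (1 - exp lq) * q_Gamma lq lp s"
    and "q_Gamma lq lp s \<noteq> 0"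
proof -
  have "q_Gamma lq lp (s + 1) = (1 - exp (s * lq)) / (1 - exp lq) * q_Gamma lq lp s
    \<and> q_Gamma lq lp s \<noteq> 0"
  proof (cases "norm (exp lq) < 1")
    case True
    then show ?thesis using q_Gamma_small_plus1[OF True _ s] lp by (simp add: q_Gamma_def)
  next
    case False
    have q': "norm (exp (- lq)) < 1"
      using False q by (simp add: exp_minus norm_inverse inverse_less_1_iff)
    have lp': "exp lp = 1 - exp (- lq)" using False lp by (simp add: exp_minus inverse_eq_divide)
    have s': "exp ((s + of_nat k) * - lq) \<noteq> 1" for k
      using s[of k] by (simp add: exp_minus)
    note small = q_Gamma_small_plus1[OF q' lp' s']
    have "exp (s * (s - 1) / 2 * lq) = exp ((s - 1) * (s - 2) / 2 * lq) * (exp (s * lq) / exp lq)"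
      by (simp add: exp_diff[symmetric] exp_add[symmetric] field_simps)
    then have "q_Gamma lq lp (s + 1)
        = exp (s * lq) / exp lq * ((1 - exp (s * - lq)) / (1 - exp (- lq))) * q_Gamma lq lp s"
      using False small(1) by (simp add: q_Gamma_def)
    also have "exp (s * lq) / exp lq * ((1 - exp (s * - lq)) / (1 - exp (- lq)))
        = (1 - exp (s * lq)) / (1 - exp lq)"
    proof -
      have "exp lq \<noteq> 1" using q by (metis norm_one)
      then show ?thesis by (simp add: exp_minus field_simps)
    qed
    finally show ?thesis using False small(2) by (simp add: q_Gamma_def)
  qed
  then show "q_Gamma lq lp (s + 1) = (1 - exp (s * lq)) / (1 - exp lq) * q_Gamma lq lp s"
    and "q_Gamma lq lp s \<noteq> 0" by auto
qed

section \<open>Symmetric brackets and Gamma quotients\<close>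

text \<open>
  Up to powers of \<open>q\<close>, the bracket is \<open>1 - q^y\<close>; the symmetric normalisation removes all stray
  powers of \<open>q\<close>, so that both types of lattice obey the same product rule \<open>lat_br_mult\<close>.
\<close>

fun lat_br :: "lattice \<Rightarrow> complex \<Rightarrow> complex" where
  "lat_br (QuadLat c1 c2 c3 l) y = y"
| "lat_br (ExpLat q c1 c2 c3 lq lc lp lk) y = exp (y * lq / 2) - exp (- (y * lq / 2))"

text \<open>On the exponential lattice the bracket is twice a hyperbolic sine, and this is twice the
  cosine. On the quadratic one, y^2/4 plays that role, since (x+y)^2/4 - (x-y)^2/4 = xy.\<close>

fun lat_cosh :: "lattice \<Rightarrow> complex \<Rightarrow> complex" where
  "lat_cosh (QuadLat c1 c2 c3 l) y = y\<^sup>2 / 4"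
| "lat_cosh (ExpLat q c1 c2 c3 lq lc lp lk) y = exp (y * lq / 2) + exp (- (y * lq / 2))"

text \<open>The constant \<open>C\<close> of the increments. With c = \<open>lc / lq\<close>, the
  exponential is q^((c-1)/2), the factor split off when an increment is put into symmetric
  form.\<close>

fun lat_scale :: "lattice \<Rightarrow> complex" where
  "lat_scale (QuadLat c1 c2 c3 l) = c1"
| "lat_scale (ExpLat q c1 c2 c3 lq lc lp lk) = - c2 * (1 - q) * exp ((lc - lq) / 2)"

text \<open>
  The symmetric form of \<open>\<Gamma>(w + \<nu>) / \<Gamma>(w)\<close>. The exponent of \<open>q\<close> is what remains of
  \<open>q^(- \<nu> S)\<close> and of the bracketed Gamma function once \<open>\<Gamma>_q(n + \<mu>) / (\<Gamma>_q(\<mu>) n!_q)\<close> is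
  written with symmetric brackets.
\<close>

fun gamma_quot :: "lattice \<Rightarrow> complex \<Rightarrow> complex \<Rightarrow> complex" where
  "gamma_quot (QuadLat c1 c2 c3 l) w \<nu> = exp (\<nu> * l) * (Gamma (w + \<nu>) / Gamma w)"
| "gamma_quot (ExpLat q c1 c2 c3 lq lc lp lk) w \<nu> =
     exp (\<nu> * lk + \<nu> * lc / 2 - \<nu> * (2 * w + \<nu> + 1) * lq / 4) *
     (q_Gamma lq lp (w + \<nu>) / q_Gamma lq lp w)"

text \<open>The addition theorem of the hyperbolic functions. The later bracket identities reduce to
  it: products become differences of \<open>lat_cosh\<close> values, some of which coincide.\<close>

lemma lat_br_mult: "lat_br L x * lat_br L y = lat_cosh L (x + y) - lat_cosh L (x - y)"
proof (cases L)
  case (QuadLat c1 c2 c3 l)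
  then show ?thesis by (simp add: power2_eq_square field_simps)
next
  case (ExpLat q c1 c2 c3 lq lc lp lk)
  then show ?thesis
    by (simp add: algebra_simps add_divide_distrib diff_divide_distrib exp_add exp_diff exp_minus)
      (simp add: field_simps)
qed

lemma lat_br_0 [simp]: "lat_br L 0 = 0"
  by (cases L) simp_all

lemma lat_br_minus: "lat_br L (- y) = - lat_br L y"
  by (cases L) simp_all

lemma lat_br_eq_0_ExpLat:
  "lat_br (ExpLat q c1 c2 c3 lq lc lp lk) y = 0 \<longleftrightarrow> exp (y * lq) = 1"
proof -
  have "exp (y * lq) = exp (y * lq / 2) * exp (y * lq / 2)"
    using exp_add[of "y * lq / 2" "y * lq / 2"] by (simp add: mult.commute)
  then show ?thesis by (simp add: exp_minus field_simps)
qed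

text \<open>Puts both lattice types on one footing: nonzero increments and finite Gamma values
  become conditions on the same bracket.\<close>

lemma lat_Gamma_finite_iff: "lat_Gamma_finite L w \<longleftrightarrow> (\<forall>k::nat. lat_br L (w + of_nat k) \<noteq> 0)"
proof (cases L)
  case (QuadLat c1 c2 c3 l)
  have "w \<in> \<int>\<^sub>\<le>\<^sub>0 \<longleftrightarrow> (\<exists>k::nat. w + of_nat k = 0)"
    by (metis add_eq_0_iff2 minus_of_nat_in_nonpos_Ints nonpos_Ints_cases')
  with QuadLat show ?thesis by simp
next
  case (ExpLat q c1 c2 c3 lq lc lp lk)
  then show ?thesis by (simp only: lat_br_eq_0_ExpLat lat_Gamma_finite.simps)
qed

lemma lat_br_nonzero: "lat_Gamma_finite L w \<Longrightarrow> lat_br L w \<noteq> 0"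
  unfolding lat_Gamma_finite_iff by (metis add.right_neutral of_nat_0)

lemma lat_br_of_nat_nonzero:
  assumes "nonuniform_lattice L" "n > 0"
  shows "lat_br L (of_nat n) \<noteq> 0"
proof (cases L)
  case (QuadLat c1 c2 c3 l)
  then show ?thesis using assms by simp
next
  case (ExpLat q c1 c2 c3 lq lc lp lk)
  have "exp (of_nat n * lq) = q ^ n" using assms ExpLat by (simp add: exp_of_nat_mult)
  moreover have "norm (q ^ n) \<noteq> 1"
    using assms ExpLat using power_eq_1_iff[of "norm q" n] by (auto simp: norm_power)
  ultimately show ?thesis unfolding ExpLat lat_br_eq_0_ExpLat by auto
qed

lemma lat_scale_nonzero: "nonuniform_lattice L \<Longrightarrow> lat_scale L \<noteq> 0"
  by (cases L) auto

text \<open>The lattice satisfies x(-c-s) = x(s), so x(s) - x(s-1) vanishes where s + (s-1) = -c and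
  factors through the bracket of 2s - 1 + c. The index \<rho> shifts s by \<rho>/2.\<close>

lemma nabla_lat_shift:
  assumes "nonuniform_lattice L"
  shows "nabla (lat_shift L \<rho>) s = lat_scale L * lat_br L (2 * s + \<rho> - 1 + lat_c L)"
proof (cases L)
  case (QuadLat c1 c2 c3 l)
  then show ?thesis using assms
    by (simp add: nabla_def lat_shift_def field_simps power2_eq_square)
next
  case (ExpLat q c1 c2 c3 lq lc lp lk)
  define t where "t = (s + \<rho> / 2) * lq"
  have L: "c2 \<noteq> 0" "exp lq = q" "exp lc = c1 / c2" "q \<noteq> 0" "norm q \<noteq> 1"
    using assms ExpLat by auto
  then have "lq \<noteq> 0" by auto
  have half: "(2 * s + \<rho> - 1 + lc / lq) * lq / 2 = t + (lc - lq) / 2"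
    using \<open>lq \<noteq> 0\<close> by (simp add: t_def field_simps)
  have "(lc - lq) / 2 + (t + (lc - lq) / 2) = t + lc - lq" by (simp add: field_simps)
  then have "exp ((lc - lq) / 2) * exp (t + (lc - lq) / 2) = exp t * (c1 / c2) / q"
    by (simp only: L(2,3)[symmetric] exp_add[symmetric] exp_diff[symmetric] add_diff_eq)
  moreover have "exp ((lc - lq) / 2) * exp (- (t + (lc - lq) / 2)) = exp (- t)"
    by (simp add: exp_add[symmetric])
  ultimately have "lat_scale L * lat_br L (2 * s + \<rho> - 1 + lat_c L)
      = - c2 * (1 - q) * (exp t * (c1 / c2) / q - exp (- t))"
    unfolding ExpLat lat_scale.simps lat_br.simps lat_c.simps half
    by (simp only: mult.assoc right_diff_distrib)
  also have "\<dots> = c1 * exp t + c2 * exp (- t) - (c1 * (exp t / q) + c2 * (exp (- t) * q))"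
    using L by (simp add: field_simps)
  also have "\<dots> = c1 * exp t + c2 * exp (- t) - (c1 * exp (t - lq) + c2 * exp (- (t - lq)))"
    using L by (simp add: exp_diff exp_add exp_minus field_simps)
  also have "\<dots> = nabla (lat_shift L \<rho>) s"
    by (simp add: ExpLat nabla_def lat_shift_def t_def algebra_simps)
  finally show ?thesis by simp
qed

section \<open>Recurrences of the Gamma quotients\<close>

lemma q_Gamma_plus1_lattice:
  assumes "nonuniform_lattice (ExpLat q c1 c2 c3 lq lc lp lk)"
    and "lat_Gamma_finite (ExpLat q c1 c2 c3 lq lc lp lk) s"
  shows "q_Gamma lq lp (s + 1) =
      - exp (s * lq / 2) * lat_br (ExpLat q c1 c2 c3 lq lc lp lk) s / (1 - q) * q_Gamma lq lp s"
    and "q_Gamma lq lp s \<noteq> 0"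
proof -
  have "exp (s * lq) = exp (s * lq / 2) * exp (s * lq / 2)"
    using exp_add[of "s * lq / 2" "s * lq / 2"] by (simp add: mult.commute)
  then have "1 - exp (s * lq) = - exp (s * lq / 2) * lat_br (ExpLat q c1 c2 c3 lq lc lp lk) s"
    by (simp add: exp_minus right_diff_distrib)
  with q_Gamma_plus1[of lq lp s] assms show "q_Gamma lq lp (s + 1) =
      - exp (s * lq / 2) * lat_br (ExpLat q c1 c2 c3 lq lc lp lk) s / (1 - q) * q_Gamma lq lp s"
    and "q_Gamma lq lp s \<noteq> 0" by auto
qed

lemma gamma_quot_0:
  assumes "nonuniform_lattice L" "lat_Gamma_finite L w"
  shows "gamma_quot L w 0 = 1"
proof (cases L)
  case (QuadLat c1 c2 c3 l)
  then show ?thesis using assms by (simp add: Gamma_eq_zero_iff)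
next
  case (ExpLat q c1 c2 c3 lq lc lp lk)
  then show ?thesis using assms q_Gamma_plus1_lattice(2) by auto
qed

text \<open>The exponent of q in \<open>gamma_quot\<close> is quadratic in \<nu> so that its
  increment absorbs the half power q^((w+\<nu>)/2) from the functional equation; what remains is
  \<open>lat_scale\<close>.\<close>

lemma gamma_quot_step:
  assumes "nonuniform_lattice L" "lat_Gamma_finite L (w + \<nu>)"
  shows "gamma_quot L w (\<nu> + 1) = lat_scale L * lat_br L (w + \<nu>) * gamma_quot L w \<nu>"
proof (cases L)
  case (QuadLat c1 c2 c3 l)
  then show ?thesis using assms Gamma_plus1[of "w + \<nu>"]
    by (simp add: exp_add distrib_right add.assoc)
next
  case (ExpLat q c1 c2 c3 lq lc lp lk)
  have L: "c2 \<noteq> 0" "exp lq = q" "exp lk = c2 * (1 - q)\<^sup>2" "q \<noteq> 1"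
    using assms ExpLat by auto
  have G: "q_Gamma lq lp (w + (\<nu> + 1)) = - exp ((w + \<nu>) * lq / 2) * lat_br L (w + \<nu>) / (1 - q) * q_Gamma lq lp (w + \<nu>)"
    using q_Gamma_plus1_lattice(1) assms unfolding ExpLat by (metis add.assoc)
  have "(\<nu> + 1) * lk + (\<nu> + 1) * lc / 2 - (\<nu> + 1) * (2 * w + (\<nu> + 1) + 1) * lq / 4 + (w + \<nu>) * lq / 2
      = (\<nu> * lk + \<nu> * lc / 2 - \<nu> * (2 * w + \<nu> + 1) * lq / 4) + lk + (lc - lq) / 2"
    by (simp add: field_simps)
  then have "exp ((\<nu> + 1) * lk + (\<nu> + 1) * lc / 2 - (\<nu> + 1) * (2 * w + (\<nu> + 1) + 1) * lq / 4) * exp ((w + \<nu>) * lq / 2)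
      = exp (\<nu> * lk + \<nu> * lc / 2 - \<nu> * (2 * w + \<nu> + 1) * lq / 4) * (c2 * (1 - q)\<^sup>2) * exp ((lc - lq) / 2)"
    by (simp only: exp_add[symmetric] L(3)[symmetric])
  then show ?thesis using L(4)
    unfolding ExpLat gamma_quot.simps G[unfolded ExpLat] lat_scale.simps
    by (simp del: lat_br.simps add: divide_simps power2_eq_square)
qed

text \<open>Both Gamma values move by one; their half powers q^((w+\<nu>)/2) and q^(w/2) are
  balanced by the change q^(-\<nu>/2) of the prefactor.\<close>

lemma gamma_quot_shift:
  assumes "nonuniform_lattice L" "lat_Gamma_finite L w" "lat_Gamma_finite L (w + \<nu>)"
  shows "lat_br L w * gamma_quot L (w + 1) \<nu> = lat_br L (w + \<nu>) * gamma_quot L w \<nu>"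
proof (cases L)
  case (QuadLat c1 c2 c3 l)
  have "Gamma (w + 1) = w * Gamma w" "Gamma (w + 1 + \<nu>) = (w + \<nu>) * Gamma (w + \<nu>)" "w \<noteq> 0"
    using assms QuadLat Gamma_plus1[of w] Gamma_plus1[of "w + \<nu>"] by (auto simp: algebra_simps)
  then show ?thesis using QuadLat by simp
next
  case (ExpLat q c1 c2 c3 lq lc lp lk)
  have L: "q \<noteq> 1" using assms ExpLat by auto
  have br: "lat_br L w \<noteq> 0" using assms by (simp add: lat_br_nonzero)
  note G = q_Gamma_plus1_lattice[of q c1 c2 c3 lq lc lp lk, folded ExpLat, OF assms(1)]
  have 1: "q_Gamma lq lp (w + 1) = - exp (w * lq / 2) * lat_br L w / (1 - q) * q_Gamma lq lp w"
    by (rule G(1)[OF assms(2)])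
  have 2: "q_Gamma lq lp (w + 1 + \<nu>) = - exp ((w + \<nu>) * lq / 2) * lat_br L (w + \<nu>) / (1 - q) * q_Gamma lq lp (w + \<nu>)"
    using G(1)[OF assms(3)] by (simp add: add_ac)
  have "(\<nu> * lk + \<nu> * lc / 2 - \<nu> * (2 * (w + 1) + \<nu> + 1) * lq / 4) + (w + \<nu>) * lq / 2
      = (\<nu> * lk + \<nu> * lc / 2 - \<nu> * (2 * w + \<nu> + 1) * lq / 4) + w * lq / 2"
    by (simp add: field_simps)
  then have "exp (\<nu> * lk + \<nu> * lc / 2 - \<nu> * (2 * (w + 1) + \<nu> + 1) * lq / 4) * exp ((w + \<nu>) * lq / 2)
      = exp (\<nu> * lk + \<nu> * lc / 2 - \<nu> * (2 * w + \<nu> + 1) * lq / 4) * exp (w * lq / 2)"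
    by (simp only: exp_add[symmetric])
  then show ?thesis using L br G(2)[OF assms(2)]
    unfolding ExpLat gamma_quot.simps 1[unfolded ExpLat] 2[unfolded ExpLat]
    by (simp del: lat_br.simps add: divide_simps)
qed

text \<open>The exponent changes sign when (w, \<nu>) is replaced by (w + \<nu>, -\<nu>), and the
  Gamma quotient is inverted.\<close>

lemma gamma_quot_inverse:
  assumes "nonuniform_lattice L" "lat_Gamma_finite L w" "lat_Gamma_finite L (w + \<nu>)"
  shows "gamma_quot L w \<nu> * gamma_quot L (w + \<nu>) (- \<nu>) = 1"
proof (cases L)
  case (QuadLat c1 c2 c3 l)
  then show ?thesis using assms by (simp add: Gamma_eq_zero_iff exp_minus)
next
  case (ExpLat q c1 c2 c3 lq lc lp lk)
  have "q_Gamma lq lp w \<noteq> 0" "q_Gamma lq lp (w + \<nu>) \<noteq> 0"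
    using assms q_Gamma_plus1_lattice(2) unfolding ExpLat by auto
  moreover have "(\<nu> * lk + \<nu> * lc / 2 - \<nu> * (2 * w + \<nu> + 1) * lq / 4)
      + (- \<nu> * lk + - \<nu> * lc / 2 - - \<nu> * (2 * (w + \<nu>) + - \<nu> + 1) * lq / 4) = 0"
    by (simp add: field_simps)
  then have "exp (\<nu> * lk + \<nu> * lc / 2 - \<nu> * (2 * w + \<nu> + 1) * lq / 4)
      * exp (- \<nu> * lk + - \<nu> * lc / 2 - - \<nu> * (2 * (w + \<nu>) + - \<nu> + 1) * lq / 4) = 1"
    by (simp only: exp_add[symmetric] exp_zero)
  ultimately show ?thesis unfolding ExpLat gamma_quot.simps by (simp add: divide_simps)
qed

section \<open>The kernel of the fractional sum\<close>

text \<open>The symmetric q-analogue of \<Gamma>(\<mu>+n) / (\<Gamma>(\<mu>) n!). The product form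
  remains meaningful at poles of \<Gamma>(\<mu>), as needed for \<mu> = -\<alpha> with \<alpha> an
  integer.\<close>

definition br_binomial :: "lattice \<Rightarrow> complex \<Rightarrow> nat \<Rightarrow> complex" where
  "br_binomial L \<mu> n = (\<Prod>i<n. lat_br L (\<mu> + of_nat i) / lat_br L (of_nat (Suc i)))"

text \<open>Here \<open>n\<close> stands for z - t and \<open>w\<close> for z + t + \<rho> + c.
  Keeping them independent lets the kernel identities hold for free \<open>w\<close>.\<close>

definition frac_kernel :: "lattice \<Rightarrow> complex \<Rightarrow> nat \<Rightarrow> complex \<Rightarrow> complex" where
  "frac_kernel L \<mu> n w = br_binomial L \<mu> n * gamma_quot L w (\<mu> - 1)"

lemma br_binomial_0 [simp]: "br_binomial L \<mu> 0 = 1"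
  by (simp add: br_binomial_def)

lemma br_binomial_Suc:
  assumes "nonuniform_lattice L"
  shows "lat_br L (of_nat (Suc n)) * br_binomial L \<mu> (Suc n)
    = lat_br L (\<mu> + of_nat n) * br_binomial L \<mu> n"
  using lat_br_of_nat_nonzero[OF assms, of "Suc n"] by (simp add: br_binomial_def del: of_nat_Suc)

text \<open>Splits off the first factor of the product, where \<open>br_binomial_Suc\<close> splits
  off the last.\<close>

lemma br_binomial_pred:
  assumes "nonuniform_lattice L"
  shows "lat_br L (of_nat (Suc n)) * br_binomial L (\<mu> - 1) (Suc n)
    = lat_br L (\<mu> - 1) * br_binomial L \<mu> n"
proof (induction n)
  case 0
  then show ?case using br_binomial_Suc[OF assms, of 0 "\<mu> - 1"] by simp
next
  case (Suc n)
  have nz: "lat_br L (of_nat (Suc n)) \<noteq> 0"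
    by (rule lat_br_of_nat_nonzero[OF assms]) simp
  have "lat_br L (of_nat (Suc n)) * (lat_br L (of_nat (Suc (Suc n))) * br_binomial L (\<mu> - 1) (Suc (Suc n)))
      = lat_br L (of_nat (Suc n)) * (lat_br L (\<mu> - 1 + of_nat (Suc n)) * br_binomial L (\<mu> - 1) (Suc n))"
    by (simp only: br_binomial_Suc[OF assms])
  also have "\<dots> = lat_br L (\<mu> + of_nat n) * (lat_br L (of_nat (Suc n)) * br_binomial L (\<mu> - 1) (Suc n))"
    by simp
  also have "\<dots> = lat_br L (\<mu> - 1) * (lat_br L (\<mu> + of_nat n) * br_binomial L \<mu> n)"
    unfolding Suc by (simp only: mult_ac)
  also have "\<dots> = lat_br L (of_nat (Suc n)) * (lat_br L (\<mu> - 1) * br_binomial L \<mu> (Suc n))"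
    unfolding br_binomial_Suc[OF assms, symmetric] by (simp only: mult_ac)
  finally show ?case using nz mult_left_cancel by blast
qed

text \<open>Because of the factor \<open>i = 0\<close>, the kernel of order 0 lives on the diagonal
  z = t.\<close>

lemma br_binomial_zero: "n > 0 \<Longrightarrow> br_binomial L 0 n = 0"
  by (auto simp: br_binomial_def intro!: bexI[of _ 0])

lemma br_binomial_QuadLat:
  assumes "\<mu> \<notin> \<int>\<^sub>\<le>\<^sub>0"
  shows "Gamma (\<mu> + of_nat n) / (Gamma \<mu> * Gamma (of_nat n + 1))
    = br_binomial (QuadLat c1 c2 c3 l) \<mu> n"
proof -
  have "pochhammer \<mu> n / fact n = br_binomial (QuadLat c1 c2 c3 l) \<mu> n"
    by (simp add: br_binomial_def prod_dividef pochhammer_prod fact_prod_Suc atLeast0LessThan add.commute)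
  then show ?thesis
    using pochhammer_Gamma[OF assms, of n] Gamma_fact[of n, where 'a = complex]
    by (simp add: add.commute)
qed

text \<open>Each of the \<open>n\<close> functional equations contributes q^((\<mu>+i)/2) above and
  q^((i+1)/2) below, that is q^((\<mu>-1)/2); the factors -1/(1-q) cancel.\<close>

lemma br_binomial_ExpLat:
  assumes "nonuniform_lattice (ExpLat q c1 c2 c3 lq lc lp lk)"
    and "lat_Gamma_finite (ExpLat q c1 c2 c3 lq lc lp lk) \<mu>"
  shows "q_Gamma lq lp (\<mu> + of_nat n) / (q_Gamma lq lp \<mu> * q_Gamma lq lp (of_nat n + 1))
    = exp (of_nat n * (\<mu> - 1) * lq / 2) * br_binomial (ExpLat q c1 c2 c3 lq lc lp lk) \<mu> n"
proof -
  let ?L = "ExpLat q c1 c2 c3 lq lc lp lk"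
  let ?G = "q_Gamma lq lp"
  have fin1: "lat_Gamma_finite ?L 1"
    unfolding lat_Gamma_finite_iff using lat_br_of_nat_nonzero[OF assms(1), of "Suc _"]
    by (simp add: add.commute del: lat_br.simps)
  have nzmu: "?G \<mu> \<noteq> 0" by (rule q_Gamma_plus1_lattice(2)[OF assms])
  have nz1: "?G (1 + of_nat n) \<noteq> 0" for n
    by (rule q_Gamma_plus1_lattice(2)[OF assms(1) lat_Gamma_finite_add_nat[OF fin1]])
  \<comment> \<open>At 1 the numerator and denominator products agree; nonvanishing excludes the
    default value 0/0 = 0.\<close>
  have G1: "?G 1 = 1"
  proof -
    have "(\<Prod>k. 1 - exp ((1 + of_nat k) * r)) = (\<Prod>k. 1 - exp r ^ (k + 1))" for r :: complex
      by (simp add: exp_of_nat_mult[symmetric] exp_add[symmetric] algebra_simps)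
    then have "q_Gamma_small r lp 1 \<noteq> 0 \<Longrightarrow> q_Gamma_small r lp 1 = 1" for r
      by (simp add: q_Gamma_small_def split: if_splits)
    moreover have "?G 1 \<noteq> 0" using nz1[of 0] by simp
    ultimately show ?thesis unfolding q_Gamma_def by auto
  qed
  have "?G (\<mu> + of_nat n) = exp (of_nat n * (\<mu> - 1) * lq / 2) * br_binomial ?L \<mu> n * ?G \<mu> * ?G (1 + of_nat n)"
  proof (induction n)
    case 0
    then show ?case using G1 by simp
  next
    case (Suc n)
    have 1: "?G (\<mu> + of_nat (Suc n)) = - exp ((\<mu> + of_nat n) * lq / 2) * lat_br ?L (\<mu> + of_nat n) / (1 - q) * ?G (\<mu> + of_nat n)"
      using q_Gamma_plus1_lattice(1)[OF assms(1) lat_Gamma_finite_add_nat[OF assms(2), of n]]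
      by (simp add: add_ac del: lat_br.simps)
    have 2: "?G (1 + of_nat (Suc n)) = - exp ((1 + of_nat n) * lq / 2) * lat_br ?L (of_nat (Suc n)) / (1 - q) * ?G (1 + of_nat n)"
      using q_Gamma_plus1_lattice(1)[OF assms(1) lat_Gamma_finite_add_nat[OF fin1, of n]]
      by (simp add: add_ac del: lat_br.simps)
    have "(\<mu> + of_nat n) * lq / 2 + of_nat n * (\<mu> - 1) * lq / 2
        = of_nat (Suc n) * (\<mu> - 1) * lq / 2 + (1 + of_nat n) * lq / 2"
      by (simp add: field_simps)
    then have e: "exp ((\<mu> + of_nat n) * lq / 2) * exp (of_nat n * (\<mu> - 1) * lq / 2)
        = exp (of_nat (Suc n) * (\<mu> - 1) * lq / 2) * exp ((1 + of_nat n) * lq / 2)"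
      by (simp only: exp_add[symmetric])
    have "?G (\<mu> + of_nat (Suc n)) = - (exp ((\<mu> + of_nat n) * lq / 2) * exp (of_nat n * (\<mu> - 1) * lq / 2))
        * (lat_br ?L (\<mu> + of_nat n) * br_binomial ?L \<mu> n) / (1 - q) * ?G \<mu> * ?G (1 + of_nat n)"
      unfolding 1 Suc by (simp del: lat_br.simps)
    also have "\<dots> = exp (of_nat (Suc n) * (\<mu> - 1) * lq / 2) * br_binomial ?L \<mu> (Suc n) * ?G \<mu> * ?G (1 + of_nat (Suc n))"
      unfolding e br_binomial_Suc[OF assms(1), symmetric] 2 by (simp del: lat_br.simps of_nat_Suc)
    finally show ?case .
  qed
  then show ?thesis using nzmu nz1[of n] by (simp add: add.commute[of _ 1] divide_simps)
qed

text \<open>The half shifts cancel in S - Z and add up in S + Z, so two Gamma values depend on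
  \<open>n\<close> alone and give \<open>br_binomial\<close>, and two depend on \<open>w\<close> and
  give \<open>gamma_quot\<close>.\<close>

lemma gen_power_eq_kernel:
  assumes L: "nonuniform_lattice L" and mu: "lat_Gamma_finite L \<mu>"
    and z: "z = t + of_nat n" and w: "w = z + t + \<rho> + lat_c L"
  shows "1 / bracket_Gamma L \<mu> *
      gen_power L (z + (\<rho> + \<mu> - 1) / 2) (t - 1 + (\<rho> + \<mu> - 1) / 2) (\<mu> - 1) = frac_kernel L \<mu> n w"
proof -
  define S where "S = z + (\<rho> + \<mu> - 1) / 2"
  define Z where "Z = t - 1 + (\<rho> + \<mu> - 1) / 2"
  have args: "S - Z + (\<mu> - 1) = \<mu> + of_nat n" "S + Z + lat_c L + 1 = w + (\<mu> - 1)"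
    "S - Z = of_nat n + 1" "S + Z - (\<mu> - 1) + lat_c L + 1 = w"
    unfolding S_def Z_def w z by (simp_all add: field_simps)
  have gp: "gen_power L S Z (\<mu> - 1) = power_prefactor L S (\<mu> - 1) *
     (lat_Gamma L (\<mu> + of_nat n) * lat_Gamma L (w + (\<mu> - 1))) /
     (lat_Gamma L (of_nat n + 1) * lat_Gamma L w)"
    unfolding gen_power_def args(1,2,4) unfolding args(3) ..
  show ?thesis unfolding S_def[symmetric] Z_def[symmetric] gp frac_kernel_def
  proof (cases L)
    case (QuadLat c1 c2 c3 l)
    then have "\<mu> \<notin> \<int>\<^sub>\<le>\<^sub>0" using mu by simp
    from br_binomial_QuadLat[OF this, of n c1 c2 c3 l, symmetric]
    show "1 / bracket_Gamma L \<mu> * (power_prefactor L S (\<mu> - 1) *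
     (lat_Gamma L (\<mu> + of_nat n) * lat_Gamma L (w + (\<mu> - 1))) /
     (lat_Gamma L (of_nat n + 1) * lat_Gamma L w)) = br_binomial L \<mu> n * gamma_quot L w (\<mu> - 1)"
      unfolding QuadLat by (simp add: mult_ac)
  next
    case (ExpLat q c1 c2 c3 lq lc lp lk)
    have "norm q \<noteq> 1" "exp lq = q" using L ExpLat by auto
    then have "lq \<noteq> 0" by auto
    then have lc: "lat_c L * lq = lc" unfolding ExpLat by simp
    \<comment> \<open>This splits q^(-(\<mu>-1)S) into a power with \<open>n\<close>, cancelled by
      the one from \<open>br_binomial_ExpLat\<close>, and a power with \<open>w\<close>, which goes
      into \<open>gamma_quot\<close>.\<close>
    have S: "2 * S = w + of_nat n + (\<mu> - 1) - lat_c L"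
      unfolding S_def w z by (simp add: field_simps)
    have "- (\<mu> - 1) * S * lq = - (\<mu> - 1) * (2 * S) * lq / 2" by simp
    also have "\<dots> = - (\<mu> - 1) * ((w + of_nat n + (\<mu> - 1)) * lq - lc) / 2"
      unfolding S lc[symmetric] by (simp add: algebra_simps)
    finally have S2: "- (\<mu> - 1) * S * lq = - (\<mu> - 1) * ((w + of_nat n + (\<mu> - 1)) * lq - lc) / 2" .
    have "(\<mu> - 1) * lk + - (\<mu> - 1) * S * lq + of_nat n * (\<mu> - 1) * lq / 2
        = - ((\<mu> - 1) * (\<mu> - 2) / 4) * lq + ((\<mu> - 1) * lk + (\<mu> - 1) * lc / 2 - (\<mu> - 1) * (2 * w + (\<mu> - 1) + 1) * lq / 4)"
      unfolding S2 by (simp add: field_simps)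
    then have e: "exp ((\<mu> - 1) * lk) * exp (- (\<mu> - 1) * S * lq) * exp (of_nat n * (\<mu> - 1) * lq / 2)
        = exp (- ((\<mu> - 1) * (\<mu> - 2) / 4) * lq) * exp ((\<mu> - 1) * lk + (\<mu> - 1) * lc / 2 - (\<mu> - 1) * (2 * w + (\<mu> - 1) + 1) * lq / 4)"
      by (simp only: exp_add[symmetric])
    let ?G = "q_Gamma lq lp"
    have "1 / bracket_Gamma L \<mu> * (power_prefactor L S (\<mu> - 1) *
         (lat_Gamma L (\<mu> + of_nat n) * lat_Gamma L (w + (\<mu> - 1))) /
         (lat_Gamma L (of_nat n + 1) * lat_Gamma L w))
      = 1 / exp (- ((\<mu> - 1) * (\<mu> - 2) / 4) * lq) * (exp ((\<mu> - 1) * lk) * exp (- (\<mu> - 1) * S * lq))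
        * (?G (\<mu> + of_nat n) / (?G \<mu> * ?G (of_nat n + 1))) * (?G (w + (\<mu> - 1)) / ?G w)"
      unfolding ExpLat bracket_Gamma.simps power_prefactor.simps lat_Gamma.simps
      by (simp add: mult_ac)
    also have "\<dots> = 1 / exp (- ((\<mu> - 1) * (\<mu> - 2) / 4) * lq)
        * (exp ((\<mu> - 1) * lk) * exp (- (\<mu> - 1) * S * lq) * exp (of_nat n * (\<mu> - 1) * lq / 2))
        * br_binomial L \<mu> n * (?G (w + (\<mu> - 1)) / ?G w)"
      using br_binomial_ExpLat[of q c1 c2 c3 lq lc lp lk \<mu> n] L mu unfolding ExpLat by simp
    also have "\<dots> = br_binomial L \<mu> n * gamma_quot L w (\<mu> - 1)"
      unfolding e unfolding ExpLat gamma_quot.simps by simp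
    finally show "1 / bracket_Gamma L \<mu> * (power_prefactor L S (\<mu> - 1) *
     (lat_Gamma L (\<mu> + of_nat n) * lat_Gamma L (w + (\<mu> - 1))) /
     (lat_Gamma L (of_nat n + 1) * lat_Gamma L w)) = br_binomial L \<mu> n * gamma_quot L w (\<mu> - 1)" .
  qed
qed

text \<open>The diagonal case of the difference: at t = z there is no kernel value at z - 1 to
  subtract.\<close>

lemma kernel_0_step:
  assumes "nonuniform_lattice L" "lat_Gamma_finite L (w + \<mu> - 2)"
  shows "frac_kernel L \<mu> 0 w = lat_scale L * lat_br L (w + \<mu> - 2) * frac_kernel L (\<mu> - 1) 0 w"
proof -
  have "w + (\<mu> - 2) = w + \<mu> - 2" "\<mu> - 2 + 1 = \<mu> - 1" "\<mu> - 1 - 1 = \<mu> - 2" by simp_all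
  with gamma_quot_step[OF assms(1), of w "\<mu> - 2"] assms(2) show ?thesis
    by (simp add: frac_kernel_def)
qed

text \<open>Replacing z by z - 1 lowers both arguments by one. After common factors are removed, one
  bracket identity remains. Its factor [w + n + \<mu>] depends on z alone, being the bracket in the
  increment of x_(\<rho>+\<mu>-1) at z, so it can leave the sum over t.\<close>

lemma kernel_diff:
  assumes L: "nonuniform_lattice L" and w: "lat_Gamma_finite L w"
    and wmu: "lat_Gamma_finite L (w + \<mu> - 2)"
  shows "frac_kernel L \<mu> (Suc n) (w + 1) - frac_kernel L \<mu> n w
    = lat_scale L * lat_br L (w + of_nat n + \<mu>) * frac_kernel L (\<mu> - 1) (Suc n) (w + 1)"
proof -
  define H where "H = gamma_quot L (w + 1) (\<mu> - 2)"
  have wmu': "lat_Gamma_finite L (w + 1 + (\<mu> - 2))"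
    using lat_Gamma_finite_add_nat[OF wmu, of 1] by (simp add: algebra_simps)
  have "gamma_quot L (w + 1) (\<mu> - 2 + 1) = lat_scale L * lat_br L (w + 1 + (\<mu> - 2)) * H"
    unfolding H_def by (rule gamma_quot_step[OF L wmu'])
  then have H1: "gamma_quot L (w + 1) (\<mu> - 1) = lat_scale L * lat_br L (w + \<mu> - 1) * H"
    by (simp add: algebra_simps)
  have "gamma_quot L w (\<mu> - 2 + 1) = lat_scale L * lat_br L (w + (\<mu> - 2)) * gamma_quot L w (\<mu> - 2)"
    by (rule gamma_quot_step[OF L]) (use wmu in \<open>simp add: add_diff_eq\<close>)
  moreover have "lat_br L w * H = lat_br L (w + (\<mu> - 2)) * gamma_quot L w (\<mu> - 2)"
    unfolding H_def by (rule gamma_quot_shift[OF L w]) (use wmu in \<open>simp add: add_diff_eq\<close>)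
  ultimately have H0: "gamma_quot L w (\<mu> - 1) = lat_scale L * lat_br L w * H"
    by simp
  define b where "b = lat_br L (of_nat (Suc n))"
  have b: "b \<noteq> 0" unfolding b_def by (rule lat_br_of_nat_nonzero[OF L]) simp
  have P1: "b * br_binomial L \<mu> (Suc n) = lat_br L (\<mu> + of_nat n) * br_binomial L \<mu> n"
    unfolding b_def by (rule br_binomial_Suc[OF L])
  have P2: "b * br_binomial L (\<mu> - 1) (Suc n) = lat_br L (\<mu> - 1) * br_binomial L \<mu> n"
    unfolding b_def by (rule br_binomial_pred[OF L])
  \<comment> \<open>By the product rule, both subtracted \<open>lat_cosh\<close> values on the left
    are that of n + 1 - w and cancel.\<close>
  have id: "lat_br L (\<mu> + of_nat n) * lat_br L (w + \<mu> - 1) - b * lat_br L w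
      = lat_br L (w + of_nat n + \<mu>) * lat_br L (\<mu> - 1)"
    unfolding b_def lat_br_mult by (simp add: algebra_simps)
  have "b * (frac_kernel L \<mu> (Suc n) (w + 1) - frac_kernel L \<mu> n w)
      = lat_scale L * H * ((b * br_binomial L \<mu> (Suc n)) * lat_br L (w + \<mu> - 1)
          - b * lat_br L w * br_binomial L \<mu> n)"
    unfolding frac_kernel_def H0 H1 by (simp add: algebra_simps)
  also have "\<dots> = lat_scale L * H * br_binomial L \<mu> n *
      (lat_br L (\<mu> + of_nat n) * lat_br L (w + \<mu> - 1) - b * lat_br L w)"
    unfolding P1 by (simp add: algebra_simps)
  also have "\<dots> = lat_scale L * H * lat_br L (w + of_nat n + \<mu>) * (b * br_binomial L (\<mu> - 1) (Suc n))"
    unfolding id P2 by simp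
  also have "\<dots> = b * (lat_scale L * lat_br L (w + of_nat n + \<mu>) * frac_kernel L (\<mu> - 1) (Suc n) (w + 1))"
    unfolding frac_kernel_def H_def by simp
  finally show ?thesis using b by simp
qed

section \<open>Inversion of the kernel\<close>

text \<open>
  The terminating very-well-poised sum with parameters \<open>\<alpha>, - N, u + N - 1\<close> is balanced
  (they add up to \<open>u + \<alpha> - 1\<close>), hence indefinitely summable; this is its closed form.
\<close>

lemma kernel_telescope:
  assumes L: "nonuniform_lattice L" and u: "lat_Gamma_finite L (u - 1)"
    and ua: "lat_Gamma_finite L (u + \<alpha> - 1)" and k: "k \<le> N"
  defines "U \<equiv> \<lambda>i. frac_kernel L (- \<alpha>) (N - i) (u + \<alpha> + of_nat N + of_nat i) * frac_kernel L \<alpha> i (u + of_nat i)"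
  shows "lat_br L \<alpha> * lat_br L (of_nat N) * lat_br L (u + of_nat N - 1) *
      (\<Sum>i<k. U i * lat_br L (u + \<alpha> - 1 + 2 * of_nat i))
    = U k * lat_br L (of_nat k) * lat_br L (u - 1 + of_nat k) *
      lat_br L (u + \<alpha> - 1 + of_nat N + of_nat k) * lat_br L (of_nat N - \<alpha> - of_nat k)"
  using k
proof (induction k)
  case 0
  then show ?case by simp
next
  case (Suc k)
  \<comment> \<open>\<open>r\<close> is N - k - 1, which avoids subtraction of naturals in the
    kernel indices.\<close>
  then obtain r where N: "N = Suc (k + r)" by (metis add_Suc le_Suc_ex)
  have fin: "lat_Gamma_finite L (u + of_nat n)" "lat_Gamma_finite L (u + of_nat n - 1)"
    "lat_Gamma_finite L (u + of_nat n + \<alpha> - 1)" "lat_Gamma_finite L (u + \<alpha> + of_nat n)" for n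
    using lat_Gamma_finite_add_nat[OF u, of n] lat_Gamma_finite_add_nat[OF u, of "Suc n"]
      lat_Gamma_finite_add_nat[OF ua, of n] lat_Gamma_finite_add_nat[OF ua, of "Suc n"]
    by (simp_all add: algebra_simps)
  define W where "W = u + \<alpha> + of_nat N + of_nat k"
  define P Q H K where "P = br_binomial L (- \<alpha>)" and "Q = br_binomial L \<alpha>"
    and "H = (\<lambda>w. gamma_quot L w (- \<alpha> - 1))" and "K = (\<lambda>w. gamma_quot L w (\<alpha> - 1))"
  have a: "lat_br L (of_nat (Suc r)) * P (Suc r) = lat_br L (- \<alpha> + of_nat r) * P r"
    unfolding P_def by (rule br_binomial_Suc[OF L])
  have b: "lat_br L (of_nat (Suc k)) * Q (Suc k) = lat_br L (\<alpha> + of_nat k) * Q k"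
    unfolding Q_def by (rule br_binomial_Suc[OF L])
  have c: "lat_br L W * H (W + 1) = lat_br L (u + of_nat (N + k) - 1) * H W"
  proof -
    have *: "W + (- \<alpha> - 1) = u + of_nat (N + k) - 1" by (simp add: W_def)
    show ?thesis unfolding H_def *[symmetric]
      by (rule gamma_quot_shift[OF L])
        (use fin(2)[of "N + k"] fin(4)[of "N + k"] in \<open>simp_all only: *\<close>, simp add: W_def add_ac)
  qed
  have d: "lat_br L (u + of_nat k) * K (u + of_nat k + 1)
      = lat_br L (u + of_nat k + \<alpha> - 1) * K (u + of_nat k)"
    using gamma_quot_shift[OF L fin(1)[of k], of "\<alpha> - 1"] fin(3)[of k]
    by (simp add: K_def add_diff_eq)
  have U0: "U k = P (Suc r) * H W * (Q k * K (u + of_nat k))"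
    by (simp add: U_def frac_kernel_def P_def Q_def H_def K_def W_def N)
  have U1: "U (Suc k) = P r * H (W + 1) * (Q (Suc k) * K (u + of_nat k + 1))"
    by (simp add: U_def frac_kernel_def P_def Q_def H_def K_def W_def N add_ac)
  \<comment> \<open>The ratio of consecutive terms, cross-multiplied so that brackets may
    vanish.\<close>
  have step: "U (Suc k) * lat_br L (of_nat (Suc k)) * lat_br L (u + of_nat k) * lat_br L W *
      lat_br L (- \<alpha> + of_nat r)
    = U k * lat_br L (of_nat (Suc r)) * lat_br L (\<alpha> + of_nat k) *
      lat_br L (u + of_nat (N + k) - 1) * lat_br L (u + of_nat k + \<alpha> - 1)"
  proof -
    have "U (Suc k) * lat_br L (of_nat (Suc k)) * lat_br L (u + of_nat k) * lat_br L W *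
        lat_br L (- \<alpha> + of_nat r)
      = (lat_br L (- \<alpha> + of_nat r) * P r) * (lat_br L (of_nat (Suc k)) * Q (Suc k)) *
        (lat_br L W * H (W + 1)) * (lat_br L (u + of_nat k) * K (u + of_nat k + 1))"
      unfolding U1 by (simp only: mult_ac)
    also have "\<dots> = U k * lat_br L (of_nat (Suc r)) * lat_br L (\<alpha> + of_nat k) *
      lat_br L (u + of_nat (N + k) - 1) * lat_br L (u + of_nat k + \<alpha> - 1)"
      unfolding a[symmetric] b c d U0 by (simp only: mult_ac)
    finally show ?thesis .
  qed
  define y where "y = u - 1"
  \<comment> \<open>The six bracket products below are differences of these four values, so the
    induction step becomes (g-x)(p-s) + (s-g)(p-x) = (p-g)(s-x).\<close>
  define p s g x where "p = lat_cosh L (y + 2 * of_nat N)" and "s = lat_cosh L (y + 2 * \<alpha> + 2 * of_nat k)"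
    and "g = lat_cosh L (y + 2 * of_nat k)" and "x = lat_cosh L y"
  have i1: "lat_br L (u + of_nat (N + k) - 1) * lat_br L (of_nat (Suc r)) = p - g"
    unfolding lat_br_mult p_def g_def y_def N by (simp add: algebra_simps)
  have i2: "lat_br L (u + of_nat k + \<alpha> - 1) * lat_br L (\<alpha> + of_nat k) = s - x"
    unfolding lat_br_mult s_def x_def y_def N by (simp add: algebra_simps)
  have i3: "lat_br L (u - 1 + of_nat k) * lat_br L (of_nat k) = g - x"
    unfolding lat_br_mult g_def x_def y_def N by (simp add: algebra_simps)
  have i4: "lat_br L (u + \<alpha> - 1 + of_nat N + of_nat k) * lat_br L (of_nat N - \<alpha> - of_nat k) = p - s"
    unfolding lat_br_mult p_def s_def y_def N by (simp add: algebra_simps)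
  have i5: "lat_br L (u + \<alpha> - 1 + 2 * of_nat k) * lat_br L \<alpha> = s - g"
    unfolding lat_br_mult s_def g_def y_def N by (simp add: algebra_simps)
  have i6: "lat_br L (u + of_nat N - 1) * lat_br L (of_nat N) = p - x"
    unfolding lat_br_mult p_def x_def y_def N by (simp add: algebra_simps)
  have "lat_br L \<alpha> * lat_br L (of_nat N) * lat_br L (u + of_nat N - 1) *
      (\<Sum>i<Suc k. U i * lat_br L (u + \<alpha> - 1 + 2 * of_nat i))
    = U k * (lat_br L (u - 1 + of_nat k) * lat_br L (of_nat k)) *
      (lat_br L (u + \<alpha> - 1 + of_nat N + of_nat k) * lat_br L (of_nat N - \<alpha> - of_nat k))
      + U k * (lat_br L (u + \<alpha> - 1 + 2 * of_nat k) * lat_br L \<alpha>) *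
      (lat_br L (u + of_nat N - 1) * lat_br L (of_nat N))"
    using Suc by (simp add: distrib_left)
  also have "\<dots> = U k * (p - g) * (s - x)"
    unfolding i3 i4 i5 i6 by (simp add: algebra_simps)
  also have "\<dots> = U (Suc k) * lat_br L (of_nat (Suc k)) * lat_br L (u + of_nat k) * lat_br L W *
      lat_br L (- \<alpha> + of_nat r)"
    unfolding step i1[symmetric] i2[symmetric] by (simp only: mult_ac)
  also have "u + of_nat k = u - 1 + of_nat (Suc k)" by simp
  also have "W = u + \<alpha> - 1 + of_nat N + of_nat (Suc k)" by (simp add: W_def)
  also have "- \<alpha> + of_nat r = of_nat N - \<alpha> - of_nat (Suc k)" by (simp add: N)
  finally show ?case .
qed

text \<open>For \<open>N > 0\<close> the closed form of the sum up to \<open>N - 1\<close> contains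
  [-\<alpha>] = -[\<alpha>] and cancels the last term. For \<open>N = 0\<close> the increments raise
  both Gamma quotients by one step, which makes them inverse to each other.\<close>

lemma kernel_inversion:
  assumes L: "nonuniform_lattice L" and u: "lat_Gamma_finite L (u - 1)"
    and ua: "lat_Gamma_finite L (u + \<alpha> - 1)" and \<alpha>: "lat_Gamma_finite L \<alpha>"
  shows "(\<Sum>i\<le>N. frac_kernel L (- \<alpha>) (N - i) (u + \<alpha> + of_nat N + of_nat i) * frac_kernel L \<alpha> i (u + of_nat i) *
      (lat_scale L * lat_br L (u + \<alpha> - 1 + 2 * of_nat i))) * (lat_scale L * lat_br L (u - 1))
    = (if N = 0 then 1 else 0)"
proof (cases N)
  case 0
  have fin: "lat_Gamma_finite L u" "lat_Gamma_finite L (u + \<alpha>)"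
    using lat_Gamma_finite_add_nat[OF u, of 1] lat_Gamma_finite_add_nat[OF ua, of 1]
    by (simp_all add: algebra_simps)
  have "gamma_quot L u \<alpha> = lat_scale L * lat_br L (u + \<alpha> - 1) * gamma_quot L u (\<alpha> - 1)"
    using gamma_quot_step[OF L, of u "\<alpha> - 1"] ua by (simp add: add_diff_eq)
  moreover have "gamma_quot L (u + \<alpha>) (- \<alpha>)
      = lat_scale L * lat_br L (u - 1) * gamma_quot L (u + \<alpha>) (- \<alpha> - 1)"
    using gamma_quot_step[OF L, of "u + \<alpha>" "- \<alpha> - 1"] u by simp
  ultimately show ?thesis using gamma_quot_inverse[OF L fin] 0
    by (simp add: frac_kernel_def mult_ac)
next
  case (Suc M)
  let ?U = "\<lambda>i. frac_kernel L (- \<alpha>) (N - i) (u + \<alpha> + of_nat N + of_nat i) * frac_kernel L \<alpha> i (u + of_nat i)"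
  let ?S = "\<lambda>A. \<Sum>i\<in>A. ?U i * lat_br L (u + \<alpha> - 1 + 2 * of_nat i)"
  let ?c = "lat_br L \<alpha> * lat_br L (of_nat N) * lat_br L (u + of_nat N - 1)"
  have "lat_Gamma_finite L (u + of_nat N - 1)"
    using lat_Gamma_finite_add_nat[OF u, of N] by (simp add: algebra_simps)
  then have c: "?c \<noteq> 0"
    using lat_br_nonzero lat_br_of_nat_nonzero[OF L, of N] \<alpha> Suc by simp
  have "?c * ?S {..N} = ?c * ?S {..<N} + ?c * (?U N * lat_br L (u + \<alpha> - 1 + 2 * of_nat N))"
    by (simp add: lessThan_Suc_atMost[symmetric] distrib_left)
  also have "?c * ?S {..<N} = ?U N * lat_br L (of_nat N) * lat_br L (u - 1 + of_nat N) *
      lat_br L (u + \<alpha> - 1 + of_nat N + of_nat N) * lat_br L (of_nat N - \<alpha> - of_nat N)"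
    by (rule kernel_telescope[OF L u ua order_refl])
  also have "lat_br L (of_nat N - \<alpha> - of_nat N) = - lat_br L \<alpha>" by (simp add: lat_br_minus)
  also have "u - 1 + of_nat N = u + of_nat N - 1" by simp
  also have "u + \<alpha> - 1 + of_nat N + of_nat N = u + \<alpha> - 1 + 2 * of_nat N" by simp
  finally have "?c * ?S {..N} = 0" by (simp add: mult_ac)
  with c have S0: "?S {..N} = 0" using mult_eq_0_iff[of ?c "?S {..N}"] by blast
  have "(\<Sum>i\<le>N. ?U i * (lat_scale L * lat_br L (u + \<alpha> - 1 + 2 * of_nat i))) = lat_scale L * ?S {..N}"
    unfolding sum_distrib_left by (intro sum.cong refl) (simp only: mult_ac)
  also have "\<dots> = 0" unfolding S0 by simp
  finally show ?thesis using Suc by simp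
qed

section \<open>Sums over the ray\<close>

lemma mem_ray_iff: "z \<in> ray a \<longleftrightarrow> (\<exists>n::nat. z = a + 1 + of_nat n)"
proof
  assume "z \<in> ray a"
  then obtain k :: nat where "k \<ge> 1" "z = a + of_nat k" by (auto simp: ray_def)
  then have "z = a + 1 + of_nat (k - 1)" by (simp add: of_nat_diff)
  then show "\<exists>n::nat. z = a + 1 + of_nat n" by blast
next
  assume "\<exists>n::nat. z = a + 1 + of_nat n"
  then obtain n :: nat where "z = a + of_nat (Suc n)" by (auto simp: add_ac)
  then show "z \<in> ray a" unfolding ray_def by (intro CollectI exI[of _ "Suc n"]) simp
qed

lemma not_mem_ray: "a - of_nat i \<notin> ray a"
proof
  assume "a - of_nat i \<in> ray a"
  then obtain n :: nat where "a - of_nat i = a + 1 + of_nat n" by (auto simp: mem_ray_iff)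
  then have "of_nat (Suc (i + n)) = (0 :: complex)" by (simp add: algebra_simps)
  then show False by (simp only: of_nat_eq_0_iff)
qed

lemma segment_off_ray: "z \<notin> ray a \<Longrightarrow> segment a z = {}"
  unfolding segment_def mem_ray_iff by (auto simp: add.assoc simp flip: of_nat_add)

lemma segment_eq: "segment a (a + 1 + of_nat n) = (\<lambda>j. a + 1 + of_nat j) ` {..n}"
proof (intro equalityI subsetI)
  fix t assume "t \<in> segment a (a + 1 + of_nat n)"
  then obtain i j :: nat where t: "t = a + 1 + of_nat i" and "a + 1 + of_nat n = t + of_nat j"
    unfolding segment_def mem_ray_iff by auto
  then have "of_nat n = (of_nat (i + j) :: complex)" by simp
  then have "n = i + j" by (simp only: of_nat_eq_iff)
  with t show "t \<in> (\<lambda>j. a + 1 + of_nat j) ` {..n}" by auto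
next
  fix t assume "t \<in> (\<lambda>j. a + 1 + of_nat j) ` {..n}"
  then obtain j where t: "t = a + 1 + of_nat j" and "j \<le> n" by auto
  then have "a + 1 + of_nat n = t + of_nat (n - j)" by (simp add: of_nat_diff)
  with t show "t \<in> segment a (a + 1 + of_nat n)" unfolding segment_def mem_ray_iff by blast
qed

lemma sum_segment: "sum F (segment a (a + 1 + of_nat n)) = (\<Sum>j\<le>n. F (a + 1 + of_nat j))"
  unfolding segment_eq by (subst sum.reindex) (auto simp: inj_on_def)

lemma frac_sum_off_ray: "z \<notin> ray a \<Longrightarrow> frac_sum L a \<rho> \<mu> h z = 0"
  by (simp add: frac_sum_def segment_off_ray)

text \<open>At z = t = a + 1 the numerator Gamma values have their smallest arguments.\<close>

lemma frac_sum_finite_first: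
  assumes "frac_sum_finite L a \<rho> \<mu>" "\<mu> \<noteq> 0"
  shows "lat_Gamma_finite L \<mu>" "lat_Gamma_finite L (2 * (a + 1) + \<rho> + lat_c L + \<mu> - 1)"
proof -
  have "a + 1 + of_nat 0 \<in> segment a (a + 1 + of_nat 0)" unfolding segment_eq by simp
  moreover have "a + 1 + of_nat 0 \<in> ray a" unfolding mem_ray_iff by blast
  ultimately have "gen_power_finite L (a + 1 + of_nat 0 + (\<rho> + \<mu> - 1) / 2)
      (a + 1 + of_nat 0 - 1 + (\<rho> + \<mu> - 1) / 2) (\<mu> - 1)"
    using assms unfolding frac_sum_finite_def by blast
  moreover have "(a + 1 + of_nat 0 + (\<rho> + \<mu> - 1) / 2) - (a + 1 + of_nat 0 - 1 + (\<rho> + \<mu> - 1) / 2) + (\<mu> - 1) = \<mu>"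
    by simp
  moreover have "(a + 1 + of_nat 0 + (\<rho> + \<mu> - 1) / 2) + (a + 1 + of_nat 0 - 1 + (\<rho> + \<mu> - 1) / 2) + lat_c L + 1
      = 2 * (a + 1) + \<rho> + lat_c L + \<mu> - 1"
    by (simp add: field_simps)
  ultimately show "lat_Gamma_finite L \<mu>" "lat_Gamma_finite L (2 * (a + 1) + \<rho> + lat_c L + \<mu> - 1)"
    by (simp_all only: gen_power_finite_def)
qed

text \<open>The fractional sum in indices z = a+1+n, t = a+1+j. With p = 2(a+1) + \<rho> + c the
  kernel argument is p + n + j, and \<phi> includes the increments of the lattice.\<close>

definition kernel_sum :: "lattice \<Rightarrow> complex \<Rightarrow> complex \<Rightarrow> (nat \<Rightarrow> complex) \<Rightarrow> nat \<Rightarrow> complex" where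
  "kernel_sum L p \<mu> \<phi> n = (\<Sum>j\<le>n. frac_kernel L \<mu> (n - j) (p + of_nat n + of_nat j) * \<phi> j)"

lemma frac_sum_eq_kernel_sum:
  assumes L: "nonuniform_lattice L" and fin: "frac_sum_finite L a \<rho> \<mu>"
    and p: "p = 2 * (a + 1) + \<rho> + lat_c L" and pfin: "lat_Gamma_finite L p" "lat_Gamma_finite L (p - 1)"
  shows "frac_sum L a \<rho> \<mu> h (a + 1 + of_nat n)
    = kernel_sum L p \<mu> (\<lambda>j. h (a + 1 + of_nat j) * nabla (lat_shift L \<rho>) (a + 1 + of_nat j)) n"
proof (cases "\<mu> = 0")
  case False
  have "1 / bracket_Gamma L \<mu> * gen_power L (a + 1 + of_nat n + (\<rho> + \<mu> - 1) / 2)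
      (a + 1 + of_nat j - 1 + (\<rho> + \<mu> - 1) / 2) (\<mu> - 1)
    = frac_kernel L \<mu> (n - j) (p + of_nat n + of_nat j)" if "j \<le> n" for j
    by (rule gen_power_eq_kernel[OF L frac_sum_finite_first(1)[OF fin False]])
      (use that in \<open>simp_all add: p of_nat_diff algebra_simps\<close>)
  with False show ?thesis
    unfolding frac_sum_def kernel_sum_def sum_segment sum_distrib_left
    by (auto intro!: sum.cong simp: mult.assoc[symmetric])
next
  case True
  have f: "lat_Gamma_finite L (p + 2 * of_nat n)" "lat_Gamma_finite L (p + 2 * of_nat n - 1)"
    using lat_Gamma_finite_add_nat[OF pfin(1), of "2 * n"] lat_Gamma_finite_add_nat[OF pfin(2), of "2 * n"]
    by (simp_all add: algebra_simps)
  have arg: "2 * (a + 1 + of_nat n) + \<rho> - 1 + lat_c L = p + 2 * of_nat n - 1"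
    by (simp add: p algebra_simps)
  let ?\<phi> = "\<lambda>j. h (a + 1 + of_nat j) * nabla (lat_shift L \<rho>) (a + 1 + of_nat j)"
  \<comment> \<open>Order 0, which occurs for \<alpha> = m: the diagonal term alone survives, and
    the increment in \<phi> raises its Gamma quotient from exponent -1 to 0, where it is 1.\<close>
  have "kernel_sum L p 0 ?\<phi> n = (\<Sum>j\<le>n. if j = n then frac_kernel L 0 0 (p + of_nat n + of_nat n) * ?\<phi> n else 0)"
    unfolding kernel_sum_def by (intro sum.cong) (auto simp: frac_kernel_def br_binomial_zero)
  also have "\<dots> = gamma_quot L (p + 2 * of_nat n) (- 1) * ?\<phi> n"
    by (simp add: frac_kernel_def add.assoc)
  also have "\<dots> = h (a + 1 + of_nat n) * gamma_quot L (p + 2 * of_nat n) 0"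
    unfolding nabla_lat_shift[OF L] arg
    using gamma_quot_step[OF L, of "p + 2 * of_nat n" "-1"] f(2) by (simp add: mult_ac)
  also have "\<dots> = frac_sum L a \<rho> 0 h (a + 1 + of_nat n)"
    using gamma_quot_0[OF L f(1)] by (auto simp: frac_sum_def mem_ray_iff)
  finally show ?thesis using True by simp
qed

lemma kernel_sum_0_step:
  assumes "nonuniform_lattice L" "lat_Gamma_finite L (p + \<mu> - 2)"
  shows "kernel_sum L p \<mu> \<phi> 0 = lat_scale L * lat_br L (p + \<mu> - 2) * kernel_sum L p (\<mu> - 1) \<phi> 0"
  using kernel_0_step[OF assms] by (simp add: kernel_sum_def)

text \<open>Termwise \<open>kernel_diff\<close>, whose factor is the same for all \<open>j\<close>;
  the new term \<open>j = Suc n\<close> is covered by \<open>kernel_0_step\<close>.\<close>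

lemma kernel_sum_diff:
  assumes L: "nonuniform_lattice L" and p: "lat_Gamma_finite L p"
    and pmu: "lat_Gamma_finite L (p + \<mu> - 2)"
  shows "kernel_sum L p \<mu> \<phi> (Suc n) - kernel_sum L p \<mu> \<phi> n
    = lat_scale L * lat_br L (p + 2 * of_nat (Suc n) + \<mu> - 2) * kernel_sum L p (\<mu> - 1) \<phi> (Suc n)"
proof -
  let ?c = "lat_scale L * lat_br L (p + 2 * of_nat (Suc n) + \<mu> - 2)"
  have shift: "p + of_nat (Suc n) + of_nat j = p + of_nat n + of_nat j + 1" for j
    by simp
  have diff: "frac_kernel L \<mu> (Suc n - j) (p + of_nat (Suc n) + of_nat j) - frac_kernel L \<mu> (n - j) (p + of_nat n + of_nat j)
      = ?c * frac_kernel L (\<mu> - 1) (Suc n - j) (p + of_nat (Suc n) + of_nat j)" if "j \<le> n" for j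
  proof -
    have "lat_Gamma_finite L (p + of_nat n + of_nat j)" "lat_Gamma_finite L (p + of_nat n + of_nat j + \<mu> - 2)"
      using lat_Gamma_finite_add_nat[OF p, of "n + j"] lat_Gamma_finite_add_nat[OF pmu, of "n + j"]
      by (simp_all add: algebra_simps)
    from kernel_diff[OF L this, of "n - j"]
    show ?thesis unfolding shift
      using that by (simp add: Suc_diff_le of_nat_diff algebra_simps)
  qed
  have "p + of_nat (Suc n) + of_nat (Suc n) + \<mu> - 2 = p + 2 * of_nat (Suc n) + \<mu> - 2" by simp
  moreover have "lat_Gamma_finite L (p + of_nat (Suc n) + of_nat (Suc n) + \<mu> - 2)"
    using lat_Gamma_finite_add_nat[OF pmu, of "Suc n + Suc n"] by (simp add: algebra_simps)
  ultimately have last: "frac_kernel L \<mu> 0 (p + of_nat (Suc n) + of_nat (Suc n))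
      = ?c * frac_kernel L (\<mu> - 1) 0 (p + of_nat (Suc n) + of_nat (Suc n))"
    using kernel_0_step[OF L, of "p + of_nat (Suc n) + of_nat (Suc n)" \<mu>] by metis
  have "kernel_sum L p \<mu> \<phi> (Suc n) - kernel_sum L p \<mu> \<phi> n
    = (\<Sum>j\<le>n. (frac_kernel L \<mu> (Suc n - j) (p + of_nat (Suc n) + of_nat j) - frac_kernel L \<mu> (n - j) (p + of_nat n + of_nat j)) * \<phi> j)
      + frac_kernel L \<mu> 0 (p + of_nat (Suc n) + of_nat (Suc n)) * \<phi> (Suc n)"
    by (simp add: kernel_sum_def left_diff_distrib sum_subtractf)
  also have "\<dots> = (\<Sum>j\<le>n. ?c * frac_kernel L (\<mu> - 1) (Suc n - j) (p + of_nat (Suc n) + of_nat j) * \<phi> j)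
      + ?c * frac_kernel L (\<mu> - 1) 0 (p + of_nat (Suc n) + of_nat (Suc n)) * \<phi> (Suc n)"
    unfolding last using diff by (intro arg_cong2[of _ _ _ _ "(+)"] sum.cong) auto
  also have "\<dots> = ?c * kernel_sum L p (\<mu> - 1) \<phi> (Suc n)"
    by (simp add: kernel_sum_def distrib_left sum_distrib_left mult.assoc)
  finally show ?thesis .
qed

text \<open>Each difference lowers the order of the kernel while \<open>p\<close> and \<phi> stay
  fixed. The zeros at a, a-1, ... are carried through the induction because the difference at a + 1
  reaches back to a.\<close>

lemma nabla_iter_kernel_sum:
  assumes L: "nonuniform_lattice L" and p: "p = 2 * (a + 1) + \<rho> + lat_c L"
    and pfin: "lat_Gamma_finite L p" and pmu: "lat_Gamma_finite L (p + \<mu> - of_nat k - 1)"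
    and F: "\<And>n. F (a + 1 + of_nat n) = kernel_sum L p \<mu> \<phi> n"
    and F0: "\<And>i. F (a - of_nat i) = 0"
  shows "nabla_iter L (\<rho> + \<mu> - of_nat k) k F (a + 1 + of_nat n) = kernel_sum L p (\<mu> - of_nat k) \<phi> n"
    and "nabla_iter L (\<rho> + \<mu> - of_nat k) k F (a - of_nat i) = 0"
  using pmu
proof (induction k arbitrary: n i)
  case 0
  {
    case 1
    then show ?case using F by simp
  next
    case 2
    then show ?case using F0 by simp
  }
next
  case (Suc k)
  {
    fix n i
    assume fin: "lat_Gamma_finite L (p + \<mu> - of_nat (Suc k) - 1)"
    have fin': "lat_Gamma_finite L (p + \<mu> - of_nat k - 1)"
      using lat_Gamma_finite_add_nat[OF fin, of 1] by (simp add: algebra_simps)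
    have \<gamma>: "\<rho> + \<mu> - of_nat (Suc k) + 1 = \<rho> + \<mu> - of_nat k" by simp
    define G where "G = nabla_iter L (\<rho> + \<mu> - of_nat k) k F"
    define \<nu> where "\<nu> = \<mu> - of_nat k"
    have \<nu>1: "\<nu> - 1 = \<mu> - of_nat (Suc k)" by (simp add: \<nu>_def)
    have iter: "nabla_iter L (\<rho> + \<mu> - of_nat (Suc k)) (Suc k) F z
        = (G z - G (z - 1)) / nabla (lat_shift L (\<rho> + \<mu> - of_nat (Suc k))) z" for z
      by (simp only: nabla_iter.simps \<gamma> G_def[symmetric]) (simp add: nabla_def)
    have G: "G (a + 1 + of_nat n) = kernel_sum L p \<nu> \<phi> n" for n
      unfolding G_def \<nu>_def by (rule Suc.IH(1)[OF fin'])
    have G0: "G (a - of_nat i) = 0" for i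
      unfolding G_def by (rule Suc.IH(2)[OF fin'])
    have p\<nu>: "lat_Gamma_finite L (p + \<nu> - 2)"
      using fin by (simp add: \<nu>_def algebra_simps)
    have incr: "nabla (lat_shift L (\<rho> + \<mu> - of_nat (Suc k))) (a + 1 + of_nat n)
        = lat_scale L * lat_br L (p + 2 * of_nat n + \<nu> - 2)" for n
      unfolding nabla_lat_shift[OF L] by (simp add: p \<nu>_def algebra_simps)
    have "lat_Gamma_finite L (p + 2 * of_nat n + \<nu> - 2)"
      using lat_Gamma_finite_add_nat[OF p\<nu>, of "2 * n"] by (simp add: algebra_simps)
    then have nz: "lat_scale L * lat_br L (p + 2 * of_nat n + \<nu> - 2) \<noteq> 0"
      using lat_scale_nonzero[OF L] lat_br_nonzero by simp
    have "nabla_iter L (\<rho> + \<mu> - of_nat (Suc k)) (Suc k) F (a + 1 + of_nat n)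
        = kernel_sum L p (\<nu> - 1) \<phi> n"
    proof (cases n)
      case 0
      have "G (a + 1 + of_nat 0 - 1) = 0" using G0[of 0] by simp
      then show ?thesis unfolding iter incr 0 G kernel_sum_0_step[OF L p\<nu>]
        using nz by (simp add: 0)
    next
      case (Suc l)
      have "a + 1 + of_nat (Suc l) - 1 = a + 1 + of_nat l" by simp
      then have "G (a + 1 + of_nat n) - G (a + 1 + of_nat n - 1)
          = lat_scale L * lat_br L (p + 2 * of_nat n + \<nu> - 2) * kernel_sum L p (\<nu> - 1) \<phi> n"
        unfolding Suc by (simp only: G kernel_sum_diff[OF L pfin p\<nu>])
      then show ?thesis unfolding iter incr using nz by simp
    qed
    then show "nabla_iter L (\<rho> + \<mu> - of_nat (Suc k)) (Suc k) F (a + 1 + of_nat n)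
        = kernel_sum L p (\<mu> - of_nat (Suc k)) \<phi> n"
      unfolding \<nu>1 .
    have "G (a - of_nat i - 1) = 0" using G0[of "Suc i"] by (simp add: algebra_simps)
    then show "nabla_iter L (\<rho> + \<mu> - of_nat (Suc k)) (Suc k) F (a - of_nat i) = 0"
      unfolding iter G0 by simp
  }
qed

text \<open>After the order of summation is exchanged, each inner sum is a convolution of the two
  kernels and is evaluated by \<open>kernel_inversion\<close>. The outer sum lives on the lattice
  shifted by \<alpha>, hence the base p + \<alpha>.\<close>

lemma kernel_sum_inverse:
  assumes L: "nonuniform_lattice L" and p: "lat_Gamma_finite L (p - 1)"
    and pa: "lat_Gamma_finite L (p + \<alpha> - 1)" and \<alpha>: "lat_Gamma_finite L \<alpha>"
  shows "kernel_sum L (p + \<alpha>) (- \<alpha>) (\<lambda>j. kernel_sum L p \<alpha>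
        (\<lambda>i. h i * (lat_scale L * lat_br L (p + 2 * of_nat i - 1))) j *
        (lat_scale L * lat_br L (p + \<alpha> + 2 * of_nat j - 1))) n = h n"
proof -
  define A where "A = (\<lambda>j i. frac_kernel L (- \<alpha>) (n - j) (p + \<alpha> + of_nat n + of_nat j) *
    (lat_scale L * lat_br L (p + \<alpha> + 2 * of_nat j - 1)) *
    (frac_kernel L \<alpha> (j - i) (p + of_nat j + of_nat i) *
    (h i * (lat_scale L * lat_br L (p + 2 * of_nat i - 1)))))"
  have inner: "(\<Sum>j\<in>{i..n}. A j i) = (if i = n then h i else 0)" if "i \<le> n" for i
  proof -
    define u where "u = p + 2 * of_nat i"
    define N where "N = n - i"
    have n: "n = N + i" using that by (simp add: N_def)
    have fin: "lat_Gamma_finite L (u - 1)" "lat_Gamma_finite L (u + \<alpha> - 1)"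
      using lat_Gamma_finite_add_nat[OF p, of "2 * i"] lat_Gamma_finite_add_nat[OF pa, of "2 * i"]
      by (simp_all add: u_def algebra_simps)
    have "(\<Sum>j\<in>{i..n}. A j i) = (\<Sum>k\<le>N. A (k + i) i)"
      using sum.shift_bounds_cl_nat_ivl[of "\<lambda>j. A j i" 0 i N] by (simp add: n atMost_atLeast0)
    also have "\<dots> = h i * ((\<Sum>k\<le>N. frac_kernel L (- \<alpha>) (N - k) (u + \<alpha> + of_nat N + of_nat k) *
        frac_kernel L \<alpha> k (u + of_nat k) * (lat_scale L * lat_br L (u + \<alpha> - 1 + 2 * of_nat k))) *
        (lat_scale L * lat_br L (u - 1)))"
      unfolding sum_distrib_left sum_distrib_right
    proof (rule sum.cong[OF refl])
      fix k assume "k \<in> {..N}"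
      have "p + \<alpha> + of_nat n + of_nat (k + i) = u + \<alpha> + of_nat N + of_nat k"
        "p + \<alpha> + 2 * of_nat (k + i) - 1 = u + \<alpha> - 1 + 2 * of_nat k"
        "p + of_nat (k + i) + of_nat i = u + of_nat k" "p + 2 * of_nat i - 1 = u - 1"
        "n - (k + i) = N - k" "k + i - i = k"
        by (simp_all add: u_def n algebra_simps)
      then show "A (k + i) i = h i * (frac_kernel L (- \<alpha>) (N - k) (u + \<alpha> + of_nat N + of_nat k) *
        frac_kernel L \<alpha> k (u + of_nat k) * (lat_scale L * lat_br L (u + \<alpha> - 1 + 2 * of_nat k)) *
        (lat_scale L * lat_br L (u - 1)))"
        unfolding A_def by (simp only: mult_ac)
    qed
    also have "\<dots> = h i * (if N = 0 then 1 else 0)"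
      unfolding kernel_inversion[OF L fin \<alpha>] ..
    finally show ?thesis by (simp add: n)
  qed
  have "kernel_sum L (p + \<alpha>) (- \<alpha>) (\<lambda>j. kernel_sum L p \<alpha>
        (\<lambda>i. h i * (lat_scale L * lat_br L (p + 2 * of_nat i - 1))) j *
        (lat_scale L * lat_br L (p + \<alpha> + 2 * of_nat j - 1))) n = (\<Sum>j\<le>n. \<Sum>i\<le>j. A j i)"
    unfolding kernel_sum_def A_def sum_distrib_left sum_distrib_right
    by (intro sum.cong refl) (simp only: mult_ac)
  also have "\<dots> = (\<Sum>i\<le>n. \<Sum>j\<in>{i..n}. A j i)"
    by (induction n) (simp_all add: sum.distrib)
  also have "\<dots> = (\<Sum>i\<le>n. if i = n then h i else 0)"
    using inner by (intro sum.cong) auto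
  also have "\<dots> = h n" by simp
  finally show ?thesis .
qed

section \<open>The solution of the generalized Abel equation\<close>

theorem theorem16:
  fixes L :: lattice and a \<gamma> \<alpha> :: complex and m :: nat and f g :: "complex \<Rightarrow> complex"
  assumes "nonuniform_lattice L"
    and "0 < real m - 1" and "real m - 1 < Re \<alpha>" and "Re \<alpha> \<le> real m"
    and "frac_sum_finite L a \<gamma> \<alpha>"
    and "frac_sum_finite L a (\<gamma> + \<alpha>) (of_nat m - \<alpha>)"
    and "\<forall>z\<in>ray a. nabla_iter_denoms_nonzero L \<gamma> m z"
    and "\<forall>z\<in>ray a. frac_sum L a \<gamma> \<alpha> g z = f z"
  shows "\<forall>z\<in>ray a. g z = nabla_iter L \<gamma> m (frac_sum L a (\<gamma> + \<alpha>) (of_nat m - \<alpha>) f) z"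
proof
  fix z assume "z \<in> ray a"
  then obtain n where z: "z = a + 1 + of_nat n" unfolding mem_ray_iff by blast
  note L = assms(1)
  have m: "m \<ge> 2" using assms(2) by linarith
  have "\<alpha> \<noteq> 0" using assms(2,3) by auto
  note \<alpha> = frac_sum_finite_first[OF assms(5) this]
  define p where "p = 2 * (a + 1) + \<gamma> + lat_c L"
  \<comment> \<open>Even \<open>k\<close> are reached by increments of x_\<gamma> and odd
    \<open>k\<close> by those of x_(\<gamma>+1), at the point a + 1 + k div 2 in both cases.\<close>
  have br: "lat_br L (p - 1 + of_nat k) \<noteq> 0" for k
  proof -
    define t where "t = a + 1 + of_nat (k div 2)"
    have "t \<in> ray a" unfolding t_def mem_ray_iff by blast
    moreover have "k mod 2 < m" using m by (simp add: less_le_trans[OF mod_less_divisor])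
    ultimately have "nabla (lat_shift L (\<gamma> + of_nat (k mod 2))) (t - of_nat 0) \<noteq> 0"
      using assms(7) unfolding nabla_iter_denoms_nonzero_def by blast
    moreover have "p - 1 + of_nat k = 2 * t + (\<gamma> + of_nat (k mod 2)) - 1 + lat_c L"
    proof -
      have "(of_nat k :: complex) = of_nat (2 * (k div 2) + k mod 2)" by simp
      also have "\<dots> = 2 * of_nat (k div 2) + of_nat (k mod 2)"
        by (simp only: of_nat_add of_nat_mult of_nat_numeral)
      finally show ?thesis by (simp add: p_def t_def algebra_simps)
    qed
    ultimately show ?thesis
      unfolding nabla_lat_shift[OF L] of_nat_0 diff_0_right by (simp only: mult_eq_0_iff) simp
  qed
  then have p1: "lat_Gamma_finite L (p - 1)" unfolding lat_Gamma_finite_iff by blast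
  then have p0: "lat_Gamma_finite L p" using lat_Gamma_finite_add_nat[of L "p - 1" 1] by simp
  have pa1: "lat_Gamma_finite L (p + \<alpha> - 1)" using \<alpha>(2) by (simp add: p_def)
  then have pa0: "lat_Gamma_finite L (p + \<alpha>)"
    using lat_Gamma_finite_add_nat[of L "p + \<alpha> - 1" 1] by simp
  have pa: "p + \<alpha> = 2 * (a + 1) + (\<gamma> + \<alpha>) + lat_c L" by (simp add: p_def)
  define F where "F = frac_sum L a (\<gamma> + \<alpha>) (of_nat m - \<alpha>) f"
  define \<phi> where "\<phi> = (\<lambda>j. f (a + 1 + of_nat j) * nabla (lat_shift L (\<gamma> + \<alpha>)) (a + 1 + of_nat j))"
  have F: "F (a + 1 + of_nat n) = kernel_sum L (p + \<alpha>) (of_nat m - \<alpha>) \<phi> n" for n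
    unfolding F_def \<phi>_def by (rule frac_sum_eq_kernel_sum[OF L assms(6) pa pa0 pa1])
  have F0: "F (a - of_nat i) = 0" for i
    unfolding F_def by (rule frac_sum_off_ray[OF not_mem_ray])
  \<comment> \<open>With base p + \<alpha>, order m - \<alpha> and m differences, the finiteness
    condition falls exactly on p - 1.\<close>
  have "nabla_iter L (\<gamma> + \<alpha> + (of_nat m - \<alpha>) - of_nat m) m F (a + 1 + of_nat n)
      = kernel_sum L (p + \<alpha>) (of_nat m - \<alpha> - of_nat m) \<phi> n"
    by (rule nabla_iter_kernel_sum(1)[OF L pa pa0 _ F F0]) (use p1 in simp)
  then have iter: "nabla_iter L \<gamma> m F z = kernel_sum L (p + \<alpha>) (- \<alpha>) \<phi> n"
    by (simp add: z)
  have incr: "nabla (lat_shift L \<gamma>) (a + 1 + of_nat i) = lat_scale L * lat_br L (p + 2 * of_nat i - 1)"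
    "nabla (lat_shift L (\<gamma> + \<alpha>)) (a + 1 + of_nat i) = lat_scale L * lat_br L (p + \<alpha> + 2 * of_nat i - 1)" for i
    unfolding nabla_lat_shift[OF L] by (simp_all add: p_def algebra_simps)
  have f: "f (a + 1 + of_nat j) = kernel_sum L p \<alpha>
      (\<lambda>i. g (a + 1 + of_nat i) * (lat_scale L * lat_br L (p + 2 * of_nat i - 1))) j" for j
  proof -
    have "f (a + 1 + of_nat j) = frac_sum L a \<gamma> \<alpha> g (a + 1 + of_nat j)"
      using assms(8) by (metis mem_ray_iff)
    also have "\<dots> = kernel_sum L p \<alpha>
        (\<lambda>i. g (a + 1 + of_nat i) * nabla (lat_shift L \<gamma>) (a + 1 + of_nat i)) j"
      by (rule frac_sum_eq_kernel_sum[OF L assms(5) p_def p0 p1])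
    finally show ?thesis unfolding incr .
  qed
  have "kernel_sum L (p + \<alpha>) (- \<alpha>) \<phi> n = g (a + 1 + of_nat n)"
    unfolding \<phi>_def f incr by (rule kernel_sum_inverse[OF L p1 pa1 \<alpha>(1)])
  with iter show "g z = nabla_iter L \<gamma> m (frac_sum L a (\<gamma> + \<alpha>) (of_nat m - \<alpha>) f) z"
    unfolding F_def z by simp
qed

end
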